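(* Let $\alpha<\beta$, let $\lambda>0$, and assume that $K:[0,\infty)\to[0,\infty)$ satisfies (K1), (K2) and (K3). Assume that $g\in C[\alpha,\beta]$ is non-decreasing, and let $M>0$ be a constant such that $\rho:=g(\beta)-g(\alpha)\le M$. Let $U_0$ be a minimizer of $TV_{Kg}$ (on $\Omega=(\alpha,\beta)$) among piecewise constant functions $U$ with exactly one jump in $(\alpha,\beta)$ satisfying $U(\alpha)=g(\alpha)$, $U(\beta)=g(\beta)$. Assume that $C_*:=C_M-\lambda(\beta-\alpha)/2>0$, where $C_M$ is the constant in (K2). Let $v$ be a non-decreasing function on $[\alpha,\beta]$ which is continuous at $\alpha$ and $\beta$ and satisfies $v(\alpha)=g(\alpha)$, $v(\beta)=g(\beta)$. Then $$TV_{Kg}(v)\ge\frac{C_*}{2}\left(\Big(\sum_{z_i\in J_v}\rho_i\Big)^2-\sum_{z_i\in J_v}\rho_i^2+\Big(\rho-\sum_{z_i\in J_v}\rho_i\Big)^2\right)+TV_{Kg}(U_0),$$ where $J_v=\{z_i\}\subset(\alpha,\beta)$ is the (at most countable) set of jump discontinuities of $v$ and $\rho_i=v(z_i+0)-v(z_i-0)>0$. Moreover, the non-negative term $$\Big(\sum_{z_i\in J_v}\rho_i\Big)^2-\sum_{z_i\in J_v}\rho_i^2+\Big(\rho-\sum_{z_i\in J_v}\rho_i\Big)^2$$ vanishes if and only if $\rho=\rho_{i_0}$ for some $i_0$.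
   Context: Conditions on $K$: (K1) $K$ is lower semicontinuous and non-decreasing with $K(0)=0$. (K2) For any $M>0$ there exists a constant $C_M>0$ such that $K(\rho_1)+K(\rho_2)\ge K(\rho_1+\rho_2)+C_M\rho_1\rho_2$ for all $\rho_1,\rho_2\ge0$ with $\rho_1+\rho_2\le M$. (K3) $\lim_{\rho\to0}K(\rho)/\rho=1$. For $u\in BV(\Omega)$, $\Omega=(\alpha,\beta)$, with distributional derivative $Du$, jump set $J_u$ and one-sided limits $u^\pm$ at points of $J_u$, set $$TV_K(u)=\int_{\Omega\setminus J_u}|Du|+\sum_{x\in J_u}K(|u^+(x)-u^-(x)|),\qquad TV_{Kg}(u)=TV_K(u)+\frac{\lambda}{2}\int_\Omega|u-g|^2\,dx.$$ Here $v(x\pm0)=\lim_{\delta\downarrow0}v(x\pm\delta)$. The existence of a competitor $U$ with exactly one jump presupposes $\rho>0$. *)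

theory Defs
  imports "HOL-Analysis.Analysis"
begin

section \<open>Conditions on the jump cost\<close>

definition lower_semicontinuous_on :: "real set \<Rightarrow> (real \<Rightarrow> real) \<Rightarrow> bool" where
  "lower_semicontinuous_on S f \<longleftrightarrow>
     (\<forall>x\<in>S. \<forall>c<f x. eventually (\<lambda>y. c < f y) (at x within S))"

text \<open>A function \<open>[0,\<infinity>) \<rightarrow> [0,\<infinity>)\<close> is represented by its values on \<open>{0..}\<close>;
  values at negative arguments are irrelevant.\<close>

definition K1 :: "(real \<Rightarrow> real) \<Rightarrow> bool" where
  "K1 K \<longleftrightarrow> lower_semicontinuous_on {0..} K \<and> mono_on {0..} K \<and> K 0 = 0"

definition K2_const :: "(real \<Rightarrow> real) \<Rightarrow> real \<Rightarrow> real \<Rightarrow> bool" where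
  "K2_const K M C \<longleftrightarrow> C > 0 \<and>
     (\<forall>\<rho>\<^sub>1\<ge>0. \<forall>\<rho>\<^sub>2\<ge>0. \<rho>\<^sub>1 + \<rho>\<^sub>2 \<le> M \<longrightarrow> K \<rho>\<^sub>1 + K \<rho>\<^sub>2 \<ge> K (\<rho>\<^sub>1 + \<rho>\<^sub>2) + C * \<rho>\<^sub>1 * \<rho>\<^sub>2)"

definition K2 :: "(real \<Rightarrow> real) \<Rightarrow> bool" where
  "K2 K \<longleftrightarrow> (\<forall>M>0. \<exists>C. K2_const K M C)"

definition K3 :: "(real \<Rightarrow> real) \<Rightarrow> bool" where
  "K3 K \<longleftrightarrow> ((\<lambda>\<rho>. K \<rho> / \<rho>) \<longlongrightarrow> 1) (at_right 0)"

section \<open>Functions of bounded variation on \<open>(a,b)\<close>\<close>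

definition test_fun :: "real \<Rightarrow> real \<Rightarrow> (real \<Rightarrow> real) \<Rightarrow> bool" where
  "test_fun a b \<phi> \<longleftrightarrow>
     \<phi> C1_differentiable_on UNIV \<and> closure {x. \<phi> x \<noteq> 0} \<subseteq> {a<..<b}"

text \<open>A finite signed Borel measure on \<open>(a,b)\<close> is represented by its Jordan decomposition
  \<open>(\<mu>, \<nu>)\<close>, standing for \<open>\<mu> - \<nu>\<close>. The predicate says that the distributional derivative of
  \<open>u\<close> is \<open>\<mu> - \<nu>\<close>; for given \<open>u\<close> there is at most one such pair.\<close>

definition has_derivative_measure ::
    "real \<Rightarrow> real \<Rightarrow> (real \<Rightarrow> real) \<Rightarrow> real measure \<times> real measure \<Rightarrow> bool" where
  "has_derivative_measure a b u = (\<lambda>(\<mu>, \<nu>).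
     sets \<mu> = sets (restrict_space borel {a<..<b}) \<and> finite_measure \<mu> \<and>
     sets \<nu> = sets (restrict_space borel {a<..<b}) \<and> finite_measure \<nu> \<and>
     (\<exists>S\<in>sets \<mu>. emeasure \<mu> (space \<mu> - S) = 0 \<and> emeasure \<nu> S = 0) \<and>
     (\<forall>\<phi>. test_fun a b \<phi> \<longrightarrow>
        (LINT x:{a<..<b}|lebesgue. u x * deriv \<phi> x)
          = - ((\<integral>x. \<phi> x \<partial>\<mu>) - (\<integral>x. \<phi> x \<partial>\<nu>))))"

definition BV :: "real \<Rightarrow> real \<Rightarrow> (real \<Rightarrow> real) set" where
  "BV a b = {u. set_integrable lebesgue {a<..<b} u \<and> (\<exists>D. has_derivative_measure a b u D)}"

definition derivative_measure ::
    "real \<Rightarrow> real \<Rightarrow> (real \<Rightarrow> real) \<Rightarrow> real measure \<times> real measure" where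
  "derivative_measure a b u = (THE D. has_derivative_measure a b u D)"

text \<open>The total variation measure \<open>|Du|\<close>.\<close>

definition abs_derivative :: "real \<Rightarrow> real \<Rightarrow> (real \<Rightarrow> real) \<Rightarrow> real set \<Rightarrow> ennreal" where
  "abs_derivative a b u A =
     emeasure (fst (derivative_measure a b u)) A + emeasure (snd (derivative_measure a b u)) A"

text \<open>The one-sided limits \<open>u\<^sup>\<plusminus>\<close> of a BV function are essential limits (null sets are
  disregarded), so that they depend only on the almost-everywhere class of \<open>u\<close>. Whenever the
  pointwise one-sided limit exists, the essential one is equal to it.\<close>

definition ess_left :: "real \<Rightarrow> real filter" where
  "ess_left x = inf (at_left x) (ae_filter lebesgue)"

definition ess_right :: "real \<Rightarrow> real filter" where
  "ess_right x = inf (at_right x) (ae_filter lebesgue)"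

definition jump_set :: "real \<Rightarrow> real \<Rightarrow> (real \<Rightarrow> real) \<Rightarrow> real set" where
  "jump_set a b u = {x\<in>{a<..<b}. \<exists>l r.
     (u \<longlongrightarrow> l) (ess_left x) \<and> (u \<longlongrightarrow> r) (ess_right x) \<and> l \<noteq> r}"

section \<open>The functionals\<close>

text \<open>Both functionals are extended by \<open>\<infinity>\<close> to functions outside \<open>BV\<close>.\<close>

definition TV_K :: "(real \<Rightarrow> real) \<Rightarrow> real \<Rightarrow> real \<Rightarrow> (real \<Rightarrow> real) \<Rightarrow> ennreal" where
  "TV_K K a b u =
     (if u \<in> BV a b
      then abs_derivative a b u ({a<..<b} - jump_set a b u)
         + (\<Sum>\<^sub>\<infinity>x\<in>jump_set a b u. ennreal (K \<bar>Lim (ess_right x) u - Lim (ess_left x) u\<bar>))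
      else \<infinity>)"

definition TV_Kg ::
    "(real \<Rightarrow> real) \<Rightarrow> real \<Rightarrow> (real \<Rightarrow> real) \<Rightarrow> real \<Rightarrow> real \<Rightarrow> (real \<Rightarrow> real) \<Rightarrow> ennreal" where
  "TV_Kg K lam g a b u =
     TV_K K a b u
       + ennreal (lam / 2) * (\<integral>\<^sup>+x\<in>{a<..<b}. ennreal (\<bar>u x - g x\<bar>\<^sup>2) \<partial>lebesgue)"

section \<open>Piecewise constant functions\<close>

text \<open>\<open>u\<close> is constant on every component of \<open>[a,b]\<close> minus a finite set of interior points;
  the values at those points are arbitrary.\<close>

definition piecewise_constant :: "real \<Rightarrow> real \<Rightarrow> (real \<Rightarrow> real) \<Rightarrow> bool" where
  "piecewise_constant a b u \<longleftrightarrow>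
     (\<exists>S. finite S \<and> S \<subseteq> {a<..<b} \<and>
        (\<forall>x\<in>{a..b}. \<forall>y\<in>{a..b}. x \<le> y \<and> {x..y} \<inter> S = {} \<longrightarrow> u x = u y))"

definition one_jump_competitor ::
    "(real \<Rightarrow> real) \<Rightarrow> real \<Rightarrow> real \<Rightarrow> (real \<Rightarrow> real) \<Rightarrow> bool" where
  "one_jump_competitor g a b U \<longleftrightarrow>
     piecewise_constant a b U \<and> (\<exists>!x. x \<in> jump_set a b U) \<and> U a = g a \<and> U b = g b"

definition jump_height :: "(real \<Rightarrow> real) \<Rightarrow> real \<Rightarrow> real" where
  "jump_height v z = Lim (at_right z) v - Lim (at_left z) v"

end

theory Submission
  imports Defs
begin

text \<open>Write \<open>\<rho> = v b - v a\<close> and \<open>P = \<rho>\<^sup>2 - \<Sum> r\<^sub>i\<^sup>2\<close>. Merging all jumps and the diffuse part of \<open>Dv\<close> (seen as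
  many tiny jumps) into one jump lowers \<open>TV_K\<close> by at least \<open>C\<^sub>M P / 2\<close>. For the fidelity term,
  \<open>v\<close> is the average, over levels \<open>t\<close> uniform in the range of \<open>v\<close>, of the one-jump functions
  \<open>U\<^sub>t\<close> that switch from \<open>v a\<close> to \<open>v b\<close> where \<open>v\<close> crosses \<open>t\<close>. The variance of \<open>U\<^sub>t(x)\<close>
  is \<open>(v x - v a) (v b - v x)\<close>, which is at most \<open>P / 2\<close> off the jumps; hence the fidelity
  terms of the \<open>U\<^sub>t\<close> exceed that of \<open>v\<close> by at most \<open>(b - a) P / 2\<close> on average, and the minimality of
  \<open>U\<^sub>0\<close> gives the estimate with \<open>P\<close>, which dominates the deficit in the statement.\<close>

section \<open>The jump cost\<close>

text \<open>The constant C_* is the balance of the two estimates: merging gains C_M P / 2, while the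
  weight lam / 2 turns the average fidelity excess into lam (b - a) P / 4, and the difference is C_*
  P / 2. No single favourable level has to be found: minimality of \<open>U\<^sub>0\<close> is used
  at every level t and the resulting inequalities are integrated over t. The main obstacle is that
  \<open>TV_K\<close> refers to a distributional derivative selected by \<open>THE\<close>.
  Evaluating it requires both an explicit derivative measure and its uniqueness. One map serves the
  evaluation and the averaging: \<open>quantile\<close>, the generalized inverse of v, carries
  Lebesgue measure on the range of values to Dv, and \<open>quantile t\<close> is the jump point of
  U_t. As U_t is itself non-decreasing, the formula for \<open>TV_K\<close> found for v also
  evaluates it at U_t.\<close>

lemma K2_const_D:
  assumes "K2_const K M C" "x \<ge> 0" "y \<ge> 0" "x + y \<le> M"
  shows "K (x + y) + C * x * y \<le> K x + K y"
  using assms unfolding K2_const_def by blast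

text \<open>The difference between the square of the sum and the sum of the squares is twice the sum
  of all pairwise products; merging the jumps one at a time, (K2) yields \<open>C\<close> times each
  of these products once.\<close>

lemma K2_const_sum:
  assumes K: "K2_const K M C" "K 0 = 0"
    and "finite F" "\<And>z. z \<in> F \<Longrightarrow> 0 \<le> r z" "sum r F \<le> M"
  shows "K (sum r F) + C / 2 * ((sum r F)\<^sup>2 - (\<Sum>z\<in>F. (r z)\<^sup>2)) \<le> (\<Sum>z\<in>F. K (r z))"
  using assms(3-)
proof (induction F rule: finite_induct)
  case empty
  then show ?case using K by simp
next
  case (insert z F)
  have nn: "0 \<le> sum r F" "0 \<le> r z" using insert by (auto intro: sum_nonneg)
  have "sum r F \<le> M" using insert.hyps insert.prems(2) nn by simp
  then have IH: "K (sum r F) + C / 2 * ((sum r F)\<^sup>2 - (\<Sum>z\<in>F. (r z)\<^sup>2)) \<le> (\<Sum>z\<in>F. K (r z))"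
    using insert by auto
  have "K (r z + sum r F) + C * r z * sum r F \<le> K (r z) + K (sum r F)"
    using K2_const_D[OF K(1) nn(2,1)] insert by simp
  then show ?case using IH insert
    by (simp add: power2_sum algebra_simps add_divide_distrib)
qed

text \<open>Subdividing \<open>x\<close> into \<open>n\<close> equal jumps costs \<open>n K(x/n)\<close>, which tends to \<open>x\<close>: diffuse
  variation is at least as expensive as a jump.\<close>

lemma K_quadratic_bound:
  assumes K: "K2_const K M C" "K 0 = 0" "K3 K" and x: "0 \<le> x" "x \<le> M"
  shows "K x + C / 2 * x\<^sup>2 \<le> x"
proof (cases "x = 0")
  case True
  then show ?thesis using K by simp
next
  case False
  then have x0: "x > 0" using x by simp
  \<comment> \<open>The squares of \<open>Suc n\<close> equal pieces add up to
    \<open>x\<^sup>2 / Suc n\<close>, which vanishes in the limit; the cost is rewritten as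
    \<open>x\<close> times the quotient in (K3).\<close>
  have *: "K x + C / 2 * (x\<^sup>2 - x\<^sup>2 / real (Suc n)) \<le> x * (K (x / real (Suc n)) / (x / real (Suc n)))" for n
  proof -
    define m where "m = real (Suc n)"
    have m: "m > 0" unfolding m_def by simp
    have s: "(\<Sum>i<Suc n. x / real (Suc n)) = x" by simp
    have "K x + C / 2 * (x\<^sup>2 - (\<Sum>i<Suc n. (x / real (Suc n))\<^sup>2)) \<le> (\<Sum>i<Suc n. K (x / real (Suc n)))"
      using K2_const_sum[OF K(1,2), of "{..<Suc n}" "\<lambda>_. x / real (Suc n)"] x s by (simp only:) simp
    then have "K x + C / 2 * (x\<^sup>2 - m * (x / m)\<^sup>2) \<le> m * K (x / m)"
      unfolding m_def by (simp del: of_nat_Suc)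
    moreover have "m * (x / m)\<^sup>2 = x\<^sup>2 / m" "m * K (x / m) = x * (K (x / m) / (x / m))"
      using x0 m by (simp_all add: power2_eq_square field_simps)
    ultimately show ?thesis unfolding m_def by simp
  qed
  have lim0: "(\<lambda>n. x / real (Suc n)) \<longlonglongrightarrow> 0"
    by real_asymp
  have "filterlim (\<lambda>n. x / real (Suc n)) (at_right 0) sequentially"
    unfolding filterlim_at using lim0 x0 by (auto simp del: of_nat_Suc)
  then have "(\<lambda>n. K (x / real (Suc n)) / (x / real (Suc n))) \<longlonglongrightarrow> 1"
    using K(3) unfolding K3_def by (rule filterlim_compose[rotated])
  from tendsto_mult[OF tendsto_const[of x] this]
  have R: "(\<lambda>n. x * (K (x / real (Suc n)) / (x / real (Suc n)))) \<longlonglongrightarrow> x" by simp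
  have "(\<lambda>n. x\<^sup>2 / real (Suc n)) \<longlonglongrightarrow> 0"
    by real_asymp
  then have "(\<lambda>n. K x + C / 2 * (x\<^sup>2 - x\<^sup>2 / real (Suc n))) \<longlonglongrightarrow> K x + C / 2 * (x\<^sup>2 - 0)"
    by (intro tendsto_intros)
  then show ?thesis
    using LIMSEQ_le[OF _ R] * by simp
qed

text \<open>For finitely many jumps of total size s, three mergers suffice: the jumps become one
  jump s, the remainder \<open>\<rho> - s\<close> becomes one jump by
  \<open>K_quadratic_bound\<close>, and (K2) joins the two.\<close>

lemma K_jump_bound:
  assumes K: "K2_const K M C" "K 0 = 0" "K3 K"
    and K_nonneg: "\<And>x. x \<ge> 0 \<Longrightarrow> K x \<ge> 0"
    and r: "\<And>z. z \<in> J \<Longrightarrow> 0 \<le> r z" "r summable_on J" "(\<lambda>z. (r z)\<^sup>2) summable_on J"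
    and \<rho>: "infsum r J \<le> \<rho>" "\<rho> \<le> M"
  shows "(\<lambda>z. K (r z)) summable_on J"
    and "K \<rho> + C / 2 * (\<rho>\<^sup>2 - (\<Sum>\<^sub>\<infinity>z\<in>J. (r z)\<^sup>2)) \<le> \<rho> - infsum r J + (\<Sum>\<^sub>\<infinity>z\<in>J. K (r z))"
proof -
  have C: "C > 0" using K unfolding K2_const_def by simp
  have fin: "sum r F \<le> infsum r J" if "finite F" "F \<subseteq> J" for F
    using finite_sum_le_infsum[of r J F] r that by auto
  have rM: "r z \<le> M" if "z \<in> J" for z
    using fin[of "{z}"] that \<rho> by simp
  have Kr: "K (r z) \<le> r z" if "z \<in> J" for z
    using K_quadratic_bound[OF K r(1)[OF that] rM[OF that]] C
    by (smt (verit, best) divide_nonneg_nonneg mult_nonneg_nonneg zero_le_power2)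
  show summ: "(\<lambda>z. K (r z)) summable_on J"
    by (rule summable_on_comparison_test[OF r(2)]) (use Kr r K_nonneg in auto)
  define X where "X = K \<rho> + C / 2 * (\<rho>\<^sup>2 - (\<Sum>\<^sub>\<infinity>z\<in>J. (r z)\<^sup>2))"
  \<comment> \<open>In terms of \<open>r z - K (r z)\<close> the claim is an upper bound for an
    infinite sum, so finite \<open>F\<close> suffice. The jumps outside \<open>F\<close> are charged
    at their full height, like diffuse variation, and so belong to the remainder
    \<open>\<rho> - s\<close>.\<close>
  have "(\<Sum>z\<in>F. r z - K (r z)) \<le> \<rho> - X" if F: "finite F" "F \<subseteq> J" for F
  proof -
    define s where "s = sum r F"
    have s: "0 \<le> s" "s \<le> \<rho>"
      using fin[OF F] \<rho> F r unfolding s_def by (auto intro: sum_nonneg)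
    have 1: "K s + C / 2 * (s\<^sup>2 - (\<Sum>z\<in>F. (r z)\<^sup>2)) \<le> (\<Sum>z\<in>F. K (r z))"
      using K2_const_sum[OF K(1,2) F(1), of r] F r s \<rho> unfolding s_def by auto
    have 2: "K (\<rho> - s) + C / 2 * (\<rho> - s)\<^sup>2 \<le> \<rho> - s"
      using K_quadratic_bound[OF K, of "\<rho> - s"] s \<rho> by simp
    have 3: "K \<rho> + C * (\<rho> - s) * s \<le> K (\<rho> - s) + K s"
      using K2_const_D[OF K(1), of "\<rho> - s" s] s \<rho> by simp
    have 4: "C / 2 * (\<Sum>z\<in>F. (r z)\<^sup>2) \<le> C / 2 * (\<Sum>\<^sub>\<infinity>z\<in>J. (r z)\<^sup>2)"
      using finite_sum_le_infsum[OF r(3) F] C by (intro mult_left_mono) auto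
    have "C / 2 * \<rho>\<^sup>2 = C / 2 * s\<^sup>2 + C / 2 * (\<rho> - s)\<^sup>2 + C * (\<rho> - s) * s"
      by (simp add: power2_eq_square algebra_simps add_divide_distrib diff_divide_distrib)
    then show ?thesis using 1 2 3 4 unfolding X_def s_def[symmetric] sum_subtractf
      by (simp add: algebra_simps)
  qed
  moreover have d: "(\<lambda>z. r z - K (r z)) summable_on J"
    by (rule summable_on_comparison_test[OF r(2)]) (use Kr r K_nonneg in auto)
  ultimately have "(\<Sum>\<^sub>\<infinity>z\<in>J. r z - K (r z)) \<le> \<rho> - X"
    by (intro infsum_le_finite_sums)
  then show "X \<le> \<rho> - infsum r J + (\<Sum>\<^sub>\<infinity>z\<in>J. K (r z))"
    using infsum_add[OF d summ] by simp
qed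

section \<open>Essential one-sided limits\<close>

lemma interval_not_AE_negligible:
  fixes a b :: real
  assumes "a < b" "AE y in lebesgue. y \<notin> {a<..<b}"
  shows False
proof -
  have "{a<..<b} \<in> null_sets lebesgue"
    using assms by (subst AE_iff_null_sets) auto
  then show False using assms(1) by (simp add: null_sets_def)
qed

text \<open>Properness of the filter makes essential limits unique, so jump sets can be read off
  from pointwise one-sided limits. It holds because one-sided neighbourhoods contain intervals of
  positive measure.\<close>

lemma ess_left_neq_bot [simp]: "ess_left x \<noteq> bot"
proof
  assume "ess_left x = bot"
  then have "eventually (\<lambda>_. False) (ess_left x)" by simp
  then obtain P Q where P: "eventually P (at_left x)" and Q: "AE y in lebesgue. Q y"
    and PQ: "\<And>y. P y \<Longrightarrow> Q y \<Longrightarrow> False"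
    unfolding ess_left_def eventually_inf by blast
  obtain b where b: "b < x" "\<And>y. b < y \<Longrightarrow> y < x \<Longrightarrow> P y"
    using P unfolding eventually_at_left_field by blast
  have "AE y in lebesgue. y \<notin> {b<..<x}" using Q by eventually_elim (use b PQ in auto)
  then show False using interval_not_AE_negligible b by blast
qed

lemma ess_right_neq_bot [simp]: "ess_right x \<noteq> bot"
proof
  assume "ess_right x = bot"
  then have "eventually (\<lambda>_. False) (ess_right x)" by simp
  then obtain P Q where P: "eventually P (at_right x)" and Q: "AE y in lebesgue. Q y"
    and PQ: "\<And>y. P y \<Longrightarrow> Q y \<Longrightarrow> False"
    unfolding ess_right_def eventually_inf by blast
  obtain b where b: "x < b" "\<And>y. x < y \<Longrightarrow> y < b \<Longrightarrow> P y"
    using P unfolding eventually_at_right_field by blast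
  have "AE y in lebesgue. y \<notin> {x<..<b}" using Q by eventually_elim (use b PQ in auto)
  then show False using interval_not_AE_negligible b by blast
qed

lemma ess_limits:
  assumes "(u \<longlongrightarrow> l) (at_left x)" "(u \<longlongrightarrow> r) (at_right x)"
  shows "(u \<longlongrightarrow> l) (ess_left x)" and "(u \<longlongrightarrow> r) (ess_right x)"
  unfolding ess_left_def ess_right_def by (rule tendsto_mono[OF inf_le1], rule assms)+

lemma jump_set_iff:
  assumes "(u \<longlongrightarrow> l) (at_left x)" "(u \<longlongrightarrow> r) (at_right x)"
  shows "x \<in> jump_set a b u \<longleftrightarrow> x \<in> {a<..<b} \<and> l \<noteq> r"
  using ess_limits[OF assms] tendsto_unique[OF ess_left_neq_bot, of u _ x]
    tendsto_unique[OF ess_right_neq_bot, of u _ x]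
  unfolding jump_set_def by blast

lemma Lim_ess_diff:
  fixes u :: "real \<Rightarrow> real"
  assumes "(u \<longlongrightarrow> l) (at_left x)" "(u \<longlongrightarrow> r) (at_right x)"
  shows "Lim (ess_right x) u - Lim (ess_left x) u = r - l" "jump_height u x = r - l"
  using ess_limits[OF assms] assms
  by (simp_all add: tendsto_Lim jump_height_def trivial_limit_at_left_real trivial_limit_at_right_real)

lemma tendsto_left_const:
  fixes u :: "real \<Rightarrow> real"
  assumes "p < x" "\<And>y. p < y \<Longrightarrow> y < x \<Longrightarrow> u y = c"
  shows "(u \<longlongrightarrow> c) (at_left x)"
  by (rule tendsto_eventually) (use assms in \<open>auto simp: eventually_at_left_field\<close>)

lemma tendsto_right_const:
  fixes u :: "real \<Rightarrow> real"
  assumes "x < q" "\<And>y. x < y \<Longrightarrow> y < q \<Longrightarrow> u y = c"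
  shows "(u \<longlongrightarrow> c) (at_right x)"
  by (rule tendsto_eventually) (use assms in \<open>auto simp: eventually_at_right_field\<close>)

section \<open>Piecewise constant functions with one jump\<close>

lemma finite_set_gap:
  fixes S :: "real set"
  assumes "finite S" "p < s" "s < q"
  obtains y z where "p \<le> y" "y < s" "s < z" "z \<le> q" "\<forall>t\<in>S. y \<le> t \<and> t \<le> z \<longrightarrow> t = s"
proof -
  \<comment> \<open>\<open>p\<close> and \<open>q\<close> act as sentinels: they keep
    \<open>Max\<close> and \<open>Min\<close> meaningful when \<open>S\<close> has no point on one
    side of \<open>s\<close>. The witnesses are midpoints between \<open>s\<close> and its nearest
    neighbours.\<close>
  define A where "A = insert p (S \<inter> {..<s})"
  define B where "B = insert q (S \<inter> {s<..})"
  define y where "y = (max p (Max A) + s) / 2"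
  define z where "z = (min q (Min B) + s) / 2"
  have A: "Max A < s" "\<And>x. x \<in> A \<Longrightarrow> x \<le> Max A" using assms unfolding A_def by auto
  have B: "s < Min B" "\<And>x. x \<in> B \<Longrightarrow> Min B \<le> x" using assms unfolding B_def by auto
  have "y < s" "p \<le> y" "s < z" "z \<le> q" "Max A < y" "z < Min B"
    using A B assms unfolding y_def z_def by (auto simp: max_def min_def field_simps)
  moreover have "x = s" if "x \<in> S" "y \<le> x" "x \<le> z" for x
  proof -
    show ?thesis
      using that A(2)[of x] B(2)[of x] \<open>Max A < y\<close> \<open>z < Min B\<close> unfolding A_def B_def by force
  qed
  ultimately show ?thesis by (intro that) auto
qed

text \<open>\<open>S\<close> may contain points at which \<open>u\<close> does not jump, for
  instance isolated exceptional values. Such a point can be bridged, and the induction on the number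
  of points of \<open>S\<close> in between bridges them all.\<close>

lemma piecewise_constant_eq:
  assumes S: "finite S"
    and const: "\<And>x y. x \<in> {a..b} \<Longrightarrow> y \<in> {a..b} \<Longrightarrow> x \<le> y \<Longrightarrow> {x..y} \<inter> S = {} \<Longrightarrow> u x = u y"
    and "a \<le> p" "p \<le> q" "q \<le> b" "p \<notin> S" "q \<notin> S" "{p<..<q} \<inter> jump_set a b u = {}"
  shows "u p = u q"
  using assms(3-)
proof (induction "card (S \<inter> {p..q})" arbitrary: p q rule: less_induct)
  case less
  show ?case
  proof (cases "S \<inter> {p..q} = {}")
    case True
    then show ?thesis using less.prems(1-3) by (intro const) auto
  next
    case False
    then obtain s where s: "s \<in> S" "p < s" "s < q"
      using less.prems by (metis IntE all_not_in_conv atLeastAtMost_iff less_eq_real_def)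
    obtain y z where yz: "p \<le> y" "y < s" "s < z" "z \<le> q" "\<forall>t\<in>S. y \<le> t \<and> t \<le> z \<longrightarrow> t = s"
      using finite_set_gap[OF S s(2,3)] .
    have l: "u x = u y" if "y < x" "x < s" for x
    proof (rule const[symmetric])
      show "{y..x} \<inter> S = {}" using that yz by fastforce
    qed (use that yz(1-4) less.prems(1-3) s in auto)
    have r: "u x = u z" if "s < x" "x < z" for x
    proof (rule const)
      show "{x..z} \<inter> S = {}" using that yz by fastforce
    qed (use that yz(1-4) less.prems(1-3) s in auto)
    have "s \<in> {a<..<b}" "s \<notin> jump_set a b u" using s less.prems by auto
    \<comment> \<open>Near \<open>s\<close> the function equals \<open>u y\<close> on the left and
      \<open>u z\<close> on the right, so these are its one-sided limits, and they agree because
      \<open>s\<close> is no jump.\<close>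
    then have yz_eq: "u y = u z"
      using jump_set_iff[OF tendsto_left_const[of _ _ u, OF yz(2) l] tendsto_right_const[of _ _ u, OF yz(3) r]] by blast
    have notin: "y \<notin> S" "z \<notin> S" using yz by fastforce+
    have card: "card (S \<inter> {p..y}) < card (S \<inter> {p..q})" "card (S \<inter> {z..q}) < card (S \<inter> {p..q})"
      by (rule psubset_card_mono; use S s yz(1-4) in force)+
    have "{p<..<y} \<subseteq> {p<..<q}" "{z<..<q} \<subseteq> {p<..<q}" using yz(1-4) s by auto
    then have disj: "{p<..<y} \<inter> jump_set a b u = {}" "{z<..<q} \<inter> jump_set a b u = {}"
      using less.prems(6) by blast+
    have "u p = u y"
      by (rule less.hyps[OF card(1)]) (use yz(1-4) notin less.prems(1-5) disj s in auto)
    moreover have "u z = u q"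
      by (rule less.hyps[OF card(2)]) (use yz(1-4) notin less.prems(1-5) disj s in auto)
    ultimately show ?thesis using yz_eq by simp
  qed
qed

text \<open>This is the source of \<open>\<rho> > 0\<close>: the two values next to the only jump
  differ, and each persists up to its endpoint.\<close>

lemma one_jump_competitor_endpoints_neq:
  assumes "one_jump_competitor g a b U"
  shows "g a \<noteq> g b"
proof -
  have "piecewise_constant a b U" using assms unfolding one_jump_competitor_def by simp
  then obtain S where S: "finite S" "S \<subseteq> {a<..<b}"
    and const': "\<forall>x\<in>{a..b}. \<forall>y\<in>{a..b}. x \<le> y \<and> {x..y} \<inter> S = {} \<longrightarrow> U x = U y"
    unfolding piecewise_constant_def by (elim exE conjE)
  have const: "U x = U y" if "x \<in> {a..b}" "y \<in> {a..b}" "x \<le> y" "{x..y} \<inter> S = {}" for x y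
    using const' that by simp
  obtain c where c: "c \<in> jump_set a b U" and c1: "\<And>x. x \<in> jump_set a b U \<Longrightarrow> x = c"
    using assms unfolding one_jump_competitor_def by auto
  have ends: "U a = g a" "U b = g b" using assms unfolding one_jump_competitor_def by auto
  have cab: "a < c" "c < b" using c unfolding jump_set_def by auto
  obtain y z where yz: "a \<le> y" "y < c" "c < z" "z \<le> b" "\<forall>t\<in>S. y \<le> t \<and> t \<le> z \<longrightarrow> t = c"
    using finite_set_gap[OF S(1) cab] .
  have l: "U x = U y" if "y < x" "x < c" for x
  proof (rule const[symmetric])
    show "{y..x} \<inter> S = {}" using that yz by fastforce
  qed (use that yz(1-4) cab in auto)
  have r: "U x = U z" if "c < x" "x < z" for x
  proof (rule const)
    show "{x..z} \<inter> S = {}" using that yz by fastforce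
  qed (use that yz(1-4) cab in auto)
  have "U y \<noteq> U z"
    using jump_set_iff[OF tendsto_left_const[of _ _ U, OF yz(2) l] tendsto_right_const[of _ _ U, OF yz(3) r]] c
    by blast
  moreover have notin: "y \<notin> S" "z \<notin> S" "a \<notin> S" "b \<notin> S"
    using yz S by fastforce+
  have "{a<..<y} \<inter> jump_set a b U = {}" "{z<..<b} \<inter> jump_set a b U = {}"
    using c1 yz(2,3) by fastforce+
  then have "U a = U y" "U z = U b"
    using yz(1-4) cab notin by (auto intro!: piecewise_constant_eq[OF S(1) const])
  ultimately show ?thesis using ends by simp
qed

section \<open>Uniqueness of the derivative measure\<close>

lemma has_real_derivative_max_square:
  "((\<lambda>x::real. (max 0 x)\<^sup>2) has_real_derivative 2 * max 0 x) (at x)"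
proof -
  consider "x < 0" | "x = 0" | "x > 0" by linarith
  then show ?thesis
  proof cases
    case 1
    show ?thesis
      by (rule has_field_derivative_transform_within_open[of "\<lambda>_. 0" _ _ "{..<0}"]) (use 1 in auto)
  next
    case 2
    have "((\<lambda>h::real. max 0 h) \<longlongrightarrow> max 0 0) (at 0)" by (intro tendsto_intros)
    moreover have "(max 0 h)\<^sup>2 / h = max 0 h" if "h \<noteq> 0" for h :: real
      using that by (auto simp: max_def power2_eq_square)
    ultimately have "((\<lambda>h::real. (max 0 h)\<^sup>2 / h) \<longlongrightarrow> 0) (at 0)"
      by (subst tendsto_cong[where g = "\<lambda>h. max 0 h"]) (auto simp: eventually_at_filter)
    then show ?thesis using 2 by (simp add: DERIV_def)
  next
    case 3
    show ?thesis
      by (rule has_field_derivative_transform_within_open[of "\<lambda>x. x\<^sup>2" _ _ "{0<..}"])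
        (use 3 in \<open>auto intro!: derivative_eq_intros\<close>)
  qed
qed

lemma C1_differentiable_real_iff:
  "(f :: real \<Rightarrow> real) C1_differentiable_on UNIV \<longleftrightarrow>
    (\<exists>D. (\<forall>x. (f has_real_derivative D x) (at x)) \<and> continuous_on UNIV D)"
  unfolding C1_differentiable_on_def has_real_derivative_iff_has_vector_derivative by simp

text \<open>The map s / (1 + s) fixes 0 and sends [0,\<infinity>) into [0,1), so ever larger
  multiples of a bump become bounded functions that tend to 1 wherever the bump is positive.\<close>

lemma C1_differentiable_saturate:
  fixes f :: "real \<Rightarrow> real"
  assumes "f C1_differentiable_on UNIV" "\<And>x. f x \<ge> 0"
  shows "(\<lambda>x. f x / (1 + f x)) C1_differentiable_on UNIV"
proof -
  obtain D where D: "\<And>x. (f has_real_derivative D x) (at x)" "continuous_on UNIV D"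
    using assms(1) unfolding C1_differentiable_real_iff by blast
  have f: "continuous_on UNIV f" using assms(1) by (rule C1_differentiable_imp_continuous_on)
  have ne: "1 + f x \<noteq> 0" for x using assms(2)[of x] by linarith
  have "((\<lambda>x. f x / (1 + f x)) has_real_derivative D x / (1 + f x)\<^sup>2) (at x)" for x
    using ne[of x] by (auto intro!: derivative_eq_intros D simp: field_simps power2_eq_square)
  moreover have "continuous_on UNIV (\<lambda>x. D x / (1 + f x)\<^sup>2)"
    using ne by (intro continuous_intros D f) auto
  ultimately show ?thesis unfolding C1_differentiable_real_iff by (intro exI[of _ "\<lambda>x. D x / (1 + f x)\<^sup>2"]) simp
qed

lemma C1_differentiable_max_square:
  "(\<lambda>x::real. (max 0 (x - c))\<^sup>2) C1_differentiable_on UNIV"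
  "(\<lambda>x::real. (max 0 (c - x))\<^sup>2) C1_differentiable_on UNIV"
proof -
  have d1: "((\<lambda>x. x - c) has_real_derivative 1) (at x)"
    and d2: "((\<lambda>x. c - x) has_real_derivative -1) (at x)" for x
    by (auto intro!: derivative_eq_intros)
  have "((\<lambda>x. (max 0 (x - c))\<^sup>2) has_real_derivative 2 * max 0 (x - c)) (at x)" for x
    using DERIV_chain2[where f = "\<lambda>x. (max 0 x)\<^sup>2" and g = "\<lambda>x. x - c", OF has_real_derivative_max_square, of 1 x UNIV] d1[of x]
    by simp
  moreover have "continuous_on UNIV (\<lambda>x. 2 * max 0 (x - c))"
    by (intro continuous_intros)
  ultimately show "(\<lambda>x::real. (max 0 (x - c))\<^sup>2) C1_differentiable_on UNIV"
    unfolding C1_differentiable_real_iff by (intro exI[of _ "\<lambda>x. 2 * max 0 (x - c)"]) simp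
  have "((\<lambda>x. (max 0 (c - x))\<^sup>2) has_real_derivative - (2 * max 0 (c - x))) (at x)" for x
    using DERIV_chain2[where f = "\<lambda>x. (max 0 x)\<^sup>2" and g = "\<lambda>x. c - x", OF has_real_derivative_max_square, of "-1" x UNIV] d2[of x]
    by simp
  moreover have "continuous_on UNIV (\<lambda>x. - (2 * max 0 (c - x)))"
    by (intro continuous_intros)
  ultimately show "(\<lambda>x::real. (max 0 (c - x))\<^sup>2) C1_differentiable_on UNIV"
    unfolding C1_differentiable_real_iff by (intro exI[of _ "\<lambda>x. - (2 * max 0 (c - x))"]) simp
qed

lemma test_fun_approximation:
  fixes a b c :: real
  assumes "a \<le> c"
  obtains \<phi> :: "nat \<Rightarrow> real \<Rightarrow> real" where
    "\<And>n. test_fun a b (\<phi> n)" "\<And>n x. \<bar>\<phi> n x\<bar> \<le> 1"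
    "\<And>x. (\<lambda>n. \<phi> n x) \<longlonglongrightarrow> indicator {c<..<b} x"
proof -
  \<comment> \<open>The margins \<open>1 / Suc n\<close> place the support in a closed interval
    strictly inside \<open>{a<..<b}\<close>; if \<open>c' n > d' n\<close>, the function is simply
    zero. The factor \<open>n\<close> in the bump drives it to infinity at every point of
    \<open>{c<..<b}\<close>.\<close>
  define c' d' where "c' n = c + 1 / real (Suc n)" and "d' n = b - 1 / real (Suc n)" for n
  define \<psi> where "\<psi> n x = real n * ((max 0 (x - c' n))\<^sup>2 * (max 0 (d' n - x))\<^sup>2)" for n x
  define \<phi> where "\<phi> n x = \<psi> n x / (1 + \<psi> n x)" for n x
  have nn: "\<psi> n x \<ge> 0" for n x unfolding \<psi>_def by simp
  have c'd': "c < c' n" "d' n < b" for n unfolding c'_def d'_def by simp_all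
  have supp: "\<phi> n x = 0" if "x \<notin> {c' n..d' n}" for n x
    using that unfolding \<phi>_def \<psi>_def by (auto simp: max_def)
  have "test_fun a b (\<phi> n)" for n
  proof -
    have "(\<psi> n) C1_differentiable_on UNIV"
      unfolding \<psi>_def by (intro C1_differentiable_on_mult C1_differentiable_max_square C1_differentiable_on_const)
    then have "(\<phi> n) C1_differentiable_on UNIV"
      unfolding \<phi>_def using nn by (intro C1_differentiable_saturate)
    moreover have "closure {x. \<phi> n x \<noteq> 0} \<subseteq> {c' n..d' n}"
      using supp by (intro closure_minimal subsetI) (blast, simp)
    ultimately show ?thesis unfolding test_fun_def using c'd'[of n] assms by fastforce
  qed
  moreover have "\<bar>\<phi> n x\<bar> \<le> 1" for n x
    using nn[of n x] unfolding \<phi>_def by simp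
  moreover have "(\<lambda>n. \<phi> n x) \<longlonglongrightarrow> indicator {c<..<b} x" for x
  proof (cases "x \<in> {c<..<b}")
    case False
    then have "\<phi> n x = 0" for n using c'd'[of n] by (intro supp) auto
    then show ?thesis using False by simp
  next
    case True
    have "c' \<longlonglongrightarrow> c" "d' \<longlonglongrightarrow> b" unfolding c'_def d'_def by real_asymp+
    then have "(\<lambda>n. (max 0 (x - c' n))\<^sup>2 * (max 0 (d' n - x))\<^sup>2) \<longlonglongrightarrow> (max 0 (x - c))\<^sup>2 * (max 0 (b - x))\<^sup>2"
      by (intro tendsto_intros)
    then have "filterlim (\<lambda>n. \<psi> n x) at_top sequentially"
      unfolding \<psi>_def mult.commute[of "real _"]
      by (rule filterlim_tendsto_pos_mult_at_top) (use True in \<open>auto intro: filterlim_real_sequentially\<close>)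
    then have "filterlim (\<lambda>n. 1 + \<psi> n x) at_top sequentially"
      by (intro filterlim_tendsto_add_at_top[OF tendsto_const])
    then have "(\<lambda>n. 1 / (1 + \<psi> n x)) \<longlonglongrightarrow> 0"
      by (rule real_tendsto_divide_at_top[OF tendsto_const])
    then have "(\<lambda>n. 1 - 1 / (1 + \<psi> n x)) \<longlonglongrightarrow> 1 - 0"
      by (intro tendsto_intros)
    moreover have "\<phi> n x = 1 - 1 / (1 + \<psi> n x)" for n
      using nn[of n x] unfolding \<phi>_def by (simp add: field_simps)
    ultimately show ?thesis using True by simp
  qed
  ultimately show ?thesis using that by blast
qed

section \<open>Finite measures tested against C1 functions\<close>

lemma test_fun_continuous:
  assumes "test_fun a b \<phi>"
  shows "continuous_on UNIV \<phi>"
  using assms C1_differentiable_imp_continuous_on unfolding test_fun_def by blast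

text \<open>This is the identity \<mu> = \<mu>' - \<nu> of signed measures with the negative part
  moved across, so that only positive measures occur. Dominated convergence gives it on the
  intervals \<open>{c<..<b}\<close>, which are the traces of rays and therefore determine finite
  measures.\<close>

lemma test_fun_integrals_determine_measure:
  fixes \<mu> \<mu>' \<nu> :: "real measure"
  assumes fin: "finite_measure \<mu>" "finite_measure \<nu>" "finite_measure \<mu>'"
    and sets: "sets \<mu> = sets (restrict_space borel {a<..<b})"
      "sets \<nu> = sets (restrict_space borel {a<..<b})"
      "sets \<mu>' = sets (restrict_space borel {a<..<b})"
    and eq: "\<And>\<phi>. test_fun a b \<phi> \<Longrightarrow> (\<integral>x. \<phi> x \<partial>\<mu>) + (\<integral>x. \<phi> x \<partial>\<nu>) = (\<integral>x. \<phi> x \<partial>\<mu>')"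
    and A: "A \<in> sets \<mu>"
  shows "emeasure \<mu> A + emeasure \<nu> A = emeasure \<mu>' A"
proof -
  let ?O = "{a<..<b}"
  have space: "space m = ?O" if "sets m = sets (restrict_space borel ?O)" for m :: "real measure"
    using sets_eq_imp_space_eq[OF that] by simp
  have sub: "X \<in> sets m" if "sets m = sets (restrict_space borel ?O)" "X \<in> sets borel" "X \<subseteq> ?O"
    for X and m :: "real measure"
    using that by (simp add: sets_restrict_space_iff)
  have meas: "f \<in> borel_measurable m"
    if "sets m = sets (restrict_space borel ?O)" "f \<in> borel_measurable borel"
    for f :: "real \<Rightarrow> real" and m
    using measurable_restrict_space1[OF that(2), of ?O] measurable_cong_sets[OF that(1) refl] by blast
  have half: "emeasure \<mu> {c<..<b} + emeasure \<nu> {c<..<b} = emeasure \<mu>' {c<..<b}" if c: "a \<le> c" for c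
  proof -
    obtain \<phi> :: "nat \<Rightarrow> real \<Rightarrow> real" where \<phi>: "\<And>n. test_fun a b (\<phi> n)" "\<And>n x. \<bar>\<phi> n x\<bar> \<le> 1"
      "\<And>x. (\<lambda>n. \<phi> n x) \<longlonglongrightarrow> indicator {c<..<b} x"
      using test_fun_approximation[OF c] by blast
    have lim: "(\<lambda>n. \<integral>x. \<phi> n x \<partial>m) \<longlonglongrightarrow> measure m {c<..<b}"
      if m: "finite_measure m" "sets m = sets (restrict_space borel ?O)" for m
    proof -
      interpret finite_measure m by fact
      have "{c<..<b} \<in> sets m" using c by (intro sub[OF m(2)]) auto
      moreover have "(\<lambda>n. \<integral>x. \<phi> n x \<partial>m) \<longlonglongrightarrow> (\<integral>x. indicator {c<..<b} x \<partial>m)"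
      proof (rule integral_dominated_convergence[where w = "\<lambda>_. 1"])
        show "\<phi> n \<in> borel_measurable m" for n
          by (intro meas[OF m(2)] borel_measurable_continuous_onI test_fun_continuous[OF \<phi>(1)])
      qed (use \<phi> calculation in auto)
      ultimately show ?thesis by simp
    qed
    have "(\<lambda>n. (\<integral>x. \<phi> n x \<partial>\<mu>) + (\<integral>x. \<phi> n x \<partial>\<nu>)) \<longlonglongrightarrow> measure \<mu> {c<..<b} + measure \<nu> {c<..<b}"
      using fin sets by (intro tendsto_add lim)
    then have "measure \<mu> {c<..<b} + measure \<nu> {c<..<b} = measure \<mu>' {c<..<b}"
      using lim[OF fin(3) sets(3)] unfolding eq[OF \<phi>(1)] by (rule LIMSEQ_unique)
    then show ?thesis
      using fin by (simp add: finite_measure.emeasure_eq_measure flip: ennreal_plus)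
  qed
  \<comment> \<open>Pushed forward to the whole line, the measures can be compared on the rays
    \<open>{x<..}\<close>; a ray meets the interval in \<open>{max x a<..<b}\<close>, so only left
    ends c \<ge> a matter.\<close>
  define E where "E m = distr m borel (\<lambda>x::real. x)" for m
  have E: "emeasure (E m) X = emeasure m (X \<inter> ?O)"
    if "sets m = sets (restrict_space borel ?O)" "X \<in> sets borel" for m X
    using that meas[OF that(1), of "\<lambda>x. x"] unfolding E_def
    by (subst emeasure_distr) (auto simp: space[OF that(1)])
  have [simp]: "sets (E m) = sets borel" for m unfolding E_def by simp
  define N where "N = measure_of UNIV (sets borel) (\<lambda>X. emeasure (E \<mu>) X + emeasure (E \<nu>) X)"
  have "countably_additive (sets borel) (\<lambda>X. emeasure (E \<mu>) X + emeasure (E \<nu>) X)"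
    unfolding countably_additive_def
    by (auto simp: suminf_add[symmetric] suminf_emeasure)
  then have N: "emeasure N X = emeasure (E \<mu>) X + emeasure (E \<nu>) X" if "X \<in> sets borel" for X
    using sets.sigma_algebra_axioms[of borel] that unfolding N_def
    by (intro emeasure_measure_of_sigma) (auto simp: positive_def)
  have sets_N: "sets N = sets borel" unfolding N_def
    using sets.sets_measure_of_eq[of borel] by simp
  have "N = E \<mu>'"
  proof (rule measure_eqI_lessThan)
    fix x :: real
    have "{x<..} \<inter> ?O = {max x a<..<b}" by auto
    then have "emeasure N {x<..} = emeasure \<mu>' {max x a<..<b}" "emeasure (E \<mu>') {x<..} = emeasure \<mu>' {max x a<..<b}"
      using half[of "max x a"] sets by (simp_all add: N E)
    then show "emeasure N {x<..} < \<infinity>" "emeasure N {x<..} = emeasure (E \<mu>') {x<..}"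
      using finite_measure.emeasure_finite[OF fin(3)] by (auto simp: top.not_eq_extremum)
  qed (simp_all add: sets_N)
  moreover have "A \<in> sets borel" "A \<inter> ?O = A"
    using A sets(1) by (auto simp: sets_restrict_space)
  ultimately show ?thesis using N[of A] E[OF sets(1), of A] E[OF sets(2), of A] E[OF sets(3), of A] by simp
qed

text \<open>If \<mu> = \<mu>' - \<nu>', then \<nu>' \<le> \<mu>'. Off the set \<open>S\<close> that
  carries \<mu>' this forces \<nu>' to vanish, and on \<open>S\<close> it vanishes by mutual
  singularity.\<close>

lemma derivative_measure_nonneg_eqI:
  assumes D: "has_derivative_measure a b u (\<mu>, null_measure (restrict_space borel {a<..<b}))"
  shows "derivative_measure a b u = (\<mu>, null_measure (restrict_space borel {a<..<b}))"
  unfolding derivative_measure_def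
proof (rule the_equality[where P = "has_derivative_measure a b u", OF D], safe)
  fix \<mu>' \<nu>' assume D': "has_derivative_measure a b u (\<mu>', \<nu>')"
  have s: "sets \<mu> = sets (restrict_space borel {a<..<b})" "sets \<mu>' = sets (restrict_space borel {a<..<b})"
    "sets \<nu>' = sets (restrict_space borel {a<..<b})"
    "finite_measure \<mu>" "finite_measure \<mu>'" "finite_measure \<nu>'"
    using D D' unfolding has_derivative_measure_def by auto
  have "(\<integral>x. \<phi> x \<partial>\<mu>) + (\<integral>x. \<phi> x \<partial>\<nu>') = (\<integral>x. \<phi> x \<partial>\<mu>')" if "test_fun a b \<phi>" for \<phi>
    using D D' that unfolding has_derivative_measure_def by (auto simp: integral_null_measure)
  then have eq: "emeasure \<mu> A + emeasure \<nu>' A = emeasure \<mu>' A" if "A \<in> sets \<mu>" for A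
    using s that by (intro test_fun_integrals_determine_measure) auto
  obtain S where S: "S \<in> sets \<mu>'" "emeasure \<mu>' (space \<mu>' - S) = 0" "emeasure \<nu>' S = 0"
    using D' unfolding has_derivative_measure_def by auto
  have sp: "space \<mu>' = space \<nu>'" "space \<mu>' = space \<mu>" using s by (metis sets_eq_imp_space_eq)+
  have comp: "space \<mu>' - S \<in> sets \<mu>" "space \<mu>' - S \<in> sets \<nu>'" "S \<in> sets \<nu>'"
    using sets.compl_sets[OF S(1)] S s by simp_all
  have "emeasure \<nu>' (space \<mu>' - S) = 0" using eq[OF comp(1)] S by simp
  then have "emeasure \<nu>' (space \<nu>') = 0"
    using S emeasure_Un_null_set[of S \<nu>' "space \<mu>' - S"] comp sets.sets_into_space[OF comp(3)] sp
    by (simp add: null_sets_def Un_absorb1)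
  then have \<nu>0: "emeasure \<nu>' A = 0" for A
    by (metis emeasure_space le_zero_eq)
  show "\<nu>' = null_measure (restrict_space borel {a<..<b})"
    using s \<nu>0 by (intro measure_eqI) auto
  show "\<mu>' = \<mu>"
    using s \<nu>0 eq by (intro measure_eqI) auto
qed

lemma test_fun_eq_0:
  assumes "test_fun a b \<phi>" "x \<notin> {a<..<b}"
  shows "\<phi> x = 0"
  using assms closure_subset[of "{x. \<phi> x \<noteq> 0}"] unfolding test_fun_def by blast

section \<open>Non-decreasing functions\<close>

text \<open>Instantiated with \<open>v\<close> and also with each one-jump step cut from
  \<open>v\<close> at a level, so that a single computation of \<open>TV_K\<close> covers
  both.\<close>

locale nondecreasing =
  fixes a b :: real and v :: "real \<Rightarrow> real"
  assumes ab: "a < b" and mono: "mono_on {a..b} v"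
    and cont_a: "continuous (at a within {a..b}) v" and cont_b: "continuous (at b within {a..b}) v"
begin

lemma le: "a \<le> x \<Longrightarrow> x \<le> y \<Longrightarrow> y \<le> b \<Longrightarrow> v x \<le> v y"
  using mono by (auto intro: mono_onD)

text \<open>Since \<open>v\<close> is arbitrary outside \<open>{a..b}\<close>, clamping the argument
  gives a monotone, hence Borel, function on the whole line for use in Fubini arguments.\<close>

definition V :: "real \<Rightarrow> real" where "V x = v (max a (min b x))"

lemma V_eq: "x \<in> {a..b} \<Longrightarrow> V x = v x"
  unfolding V_def by (auto simp: max_def min_def)

lemma V_measurable [measurable]: "V \<in> borel_measurable borel"
  unfolding V_def by (rule borel_measurable_mono, rule monoI, rule le) (use ab in auto)

lemma V_bounds: "v a \<le> V x" "V x \<le> v b"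
  unfolding V_def by (rule le; use ab in auto)+

section \<open>One-sided limits, jump heights and their sums\<close>

definition lim_left :: "real \<Rightarrow> real" where "lim_left x = (SUP y\<in>{a..<x}. v y)"
definition lim_right :: "real \<Rightarrow> real" where "lim_right x = (INF y\<in>{x<..b}. v y)"

lemma le_lim_left: "a \<le> y \<Longrightarrow> y < x \<Longrightarrow> x \<le> b \<Longrightarrow> v y \<le> lim_left x"
  unfolding lim_left_def by (rule cSUP_upper) (auto intro!: bdd_aboveI2[where M = "v b"] le)

lemma lim_right_le: "a \<le> x \<Longrightarrow> x < y \<Longrightarrow> y \<le> b \<Longrightarrow> lim_right x \<le> v y"
  unfolding lim_right_def by (rule cINF_lower) (auto intro!: bdd_belowI2[where m = "v a"] le)

lemma lim_left_le: "a < x \<Longrightarrow> x \<le> b \<Longrightarrow> lim_left x \<le> v x"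
  unfolding lim_left_def by (rule cSUP_least) (auto intro!: le)

lemma le_lim_right: "a \<le> x \<Longrightarrow> x < b \<Longrightarrow> v x \<le> lim_right x"
  unfolding lim_right_def by (rule cINF_greatest) (auto intro!: le)

lemma lim_left_le_lim_right: "a < x \<Longrightarrow> x < b \<Longrightarrow> lim_left x \<le> lim_right x"
  using lim_left_le[of x] le_lim_right[of x] by simp

lemma lim_bounds: "a < x \<Longrightarrow> x < b \<Longrightarrow> v a \<le> lim_left x" "a < x \<Longrightarrow> x < b \<Longrightarrow> lim_right x \<le> v b"
  using le_lim_left[of a x] lim_right_le[of x b] by simp_all

lemma tendsto_lim_left: "a < x \<Longrightarrow> x < b \<Longrightarrow> (v \<longlongrightarrow> lim_left x) (at_left x)"
proof (rule order_tendstoI)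
  fix c assume x: "a < x" "x < b" and "c < lim_left x"
  then obtain y where y: "y \<in> {a..<x}" "c < v y"
    unfolding lim_left_def by (subst (asm) less_cSUP_iff) (auto intro!: bdd_aboveI2[where M = "v b"] le)
  show "eventually (\<lambda>z. c < v z) (at_left x)"
  proof (rule eventually_at_leftI[of y])
    fix z assume "z \<in> {y<..<x}"
    then have "v y \<le> v z" using x y by (intro le) auto
    then show "c < v z" using y by simp
  qed (use y in auto)
next
  fix c assume x: "a < x" "x < b" and c: "lim_left x < c"
  show "eventually (\<lambda>z. v z < c) (at_left x)"
  proof (rule eventually_at_leftI[of a])
    fix z assume "z \<in> {a<..<x}"
    then have "v z \<le> lim_left x" using x by (intro le_lim_left) auto
    then show "v z < c" using c by simp
  qed (use x in auto)
qed

lemma tendsto_lim_right: "a < x \<Longrightarrow> x < b \<Longrightarrow> (v \<longlongrightarrow> lim_right x) (at_right x)"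
proof (rule order_tendstoI)
  fix c assume x: "a < x" "x < b" and "lim_right x < c"
  then obtain y where y: "y \<in> {x<..b}" "v y < c"
    unfolding lim_right_def by (subst (asm) cINF_less_iff) (auto intro!: bdd_belowI2[where m = "v a"] le)
  show "eventually (\<lambda>z. v z < c) (at_right x)"
  proof (rule eventually_at_rightI[of _ y])
    fix z assume "z \<in> {x<..<y}"
    then have "v z \<le> v y" using x y by (intro le) auto
    then show "v z < c" using y by simp
  qed (use y in auto)
next
  fix c assume x: "a < x" "x < b" and c: "c < lim_right x"
  show "eventually (\<lambda>z. c < v z) (at_right x)"
  proof (rule eventually_at_rightI[of _ b])
    fix z assume "z \<in> {x<..<b}"
    then have "lim_right x \<le> v z" using x by (intro lim_right_le) auto
    then show "c < v z" using c by simp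
  qed (use x in auto)
qed

lemma jump_set_eq: "jump_set a b v = {x \<in> {a<..<b}. lim_left x \<noteq> lim_right x}"
proof (intro set_eqI)
  fix x
  have "x \<in> jump_set a b v \<Longrightarrow> x \<in> {a<..<b}" unfolding jump_set_def by blast
  then show "x \<in> jump_set a b v \<longleftrightarrow> x \<in> {x \<in> {a<..<b}. lim_left x \<noteq> lim_right x}"
    using jump_set_iff[OF tendsto_lim_left[of x] tendsto_lim_right[of x], of a b] by auto
qed

lemma jump_height_eq:
  assumes "x \<in> {a<..<b}"
  shows "jump_height v x = lim_right x - lim_left x"
    "Lim (ess_right x) v - Lim (ess_left x) v = lim_right x - lim_left x"
  using Lim_ess_diff[OF tendsto_lim_left tendsto_lim_right] assms by auto

lemma jump_height_pos: "z \<in> jump_set a b v \<Longrightarrow> jump_height v z > 0"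
  using lim_left_le_lim_right[of z] by (auto simp: jump_set_eq jump_height_eq)

text \<open>Jumps at different points consume disjoint parts of the increment. The greatest point is
  split off, and the right end \<open>d\<close> is generalized so that the induction hypothesis
  applies to a shorter interval.\<close>

lemma sum_jump_height_le:
  assumes "finite F" "F \<subseteq> {c<..<d}" "a \<le> c" "c \<le> d" "d \<le> b"
  shows "(\<Sum>z\<in>F. jump_height v z) \<le> v d - v c"
  using assms(1,2,4,5)
proof (induction F arbitrary: d rule: finite_linorder_max_induct)
  case empty
  then show ?case using le[of c d] assms by simp
next
  case (insert m F)
  then have m: "c < m" "m < d" by auto
  \<comment> \<open>A point strictly between \<open>m\<close> and everything before it, where the
    increment is cut in two.\<close>
  define y where "y = (Max (insert c F) + m) / 2"
  have "Max (insert c F) < m" using insert m by auto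
  then have y: "Max (insert c F) < y" "y < m" unfolding y_def by auto
  then have "c < y" "\<And>z. z \<in> F \<Longrightarrow> z < y" using insert.hyps by auto
  then have "(\<Sum>z\<in>F. jump_height v z) \<le> v y - v c"
    using insert y m by (intro insert.IH) auto
  moreover have "v y \<le> lim_left m" "lim_right m \<le> v d"
    using le_lim_left[of y m] lim_right_le[of m d] y m insert.prems assms \<open>c < y\<close> by auto
  moreover have "jump_height v m = lim_right m - lim_left m"
    using m insert.prems assms by (intro jump_height_eq) auto
  moreover have "m \<notin> F" using insert.hyps by auto
  ultimately show ?case using insert.hyps(1) by simp
qed

lemma jump_set_subset: "jump_set a b v \<subseteq> {a<..<b}"
  unfolding jump_set_def by auto

lemma jump_height_summable: "jump_height v summable_on jump_set a b v"
proof (rule nonneg_bdd_above_summable_on)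
  show "bdd_above (sum (jump_height v) ` {F. F \<subseteq> jump_set a b v \<and> finite F})"
    using sum_jump_height_le[of _ a b] ab jump_set_subset
    by (intro bdd_aboveI2[where M = "v b - v a"]) auto
qed (use jump_height_pos in \<open>auto intro: less_imp_le\<close>)

lemma infsum_jump_height_le: "(\<Sum>\<^sub>\<infinity>z\<in>jump_set a b v. jump_height v z) \<le> v b - v a"
  using sum_jump_height_le[of _ a b] ab jump_set_subset
  by (intro infsum_le_finite_sums jump_height_summable) auto

lemma countable_jump_set: "countable (jump_set a b v)"
proof -
  have "{x \<in> jump_set a b v. jump_height v x \<noteq> 0} = jump_set a b v"
    using jump_height_pos by force
  then show ?thesis using summable_countable_real[OF jump_height_summable] by simp
qed

text \<open>On either side of \<open>x\<close> the sum of squares is at most the square of the sum,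
  which the increment on that side bounds. As \<open>x\<close> is no jump, every point of
  \<open>F\<close> lies on one of the two sides.\<close>

lemma sum_jump_height_square_le:
  assumes x: "x \<in> {a..b}" "x \<notin> jump_set a b v" and F: "finite F" "F \<subseteq> jump_set a b v"
  shows "(\<Sum>z\<in>F. (jump_height v z)\<^sup>2) \<le> (v x - v a)\<^sup>2 + (v b - v x)\<^sup>2"
proof -
  have pos: "0 \<le> jump_height v z" if "z \<in> F" for z
    using that F jump_height_pos[of z] by auto
  have sq: "(\<Sum>z\<in>G. (jump_height v z)\<^sup>2) \<le> (\<Sum>z\<in>G. jump_height v z)\<^sup>2" if G: "G \<subseteq> F" for G
  proof -
    have "finite G" using G F finite_subset by blast
    then have "(\<Sum>z\<in>G. jump_height v z * jump_height v z) \<le> (\<Sum>z\<in>G. jump_height v z * (\<Sum>z\<in>G. jump_height v z))"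
      using G by (intro sum_mono mult_left_mono member_le_sum pos) auto
    then show ?thesis by (simp add: sum_distrib_right power2_eq_square)
  qed
  have nn: "0 \<le> (\<Sum>z\<in>G. jump_height v z)" if "G \<subseteq> F" for G
    using that by (intro sum_nonneg pos) auto
  let ?A = "F \<inter> {..<x}" and ?B = "F \<inter> {x<..}"
  have "z < x \<or> x < z" if "z \<in> F" for z
    using that F(2) x(2) by (metis linorder_neq_iff subsetD)
  then have "F = ?A \<union> ?B" by auto
  then have "(\<Sum>z\<in>F. (jump_height v z)\<^sup>2) = (\<Sum>z\<in>?A. (jump_height v z)\<^sup>2) + (\<Sum>z\<in>?B. (jump_height v z)\<^sup>2)"
    using F by (subst sum.union_disjoint[symmetric]) auto
  also have "\<dots> \<le> (\<Sum>z\<in>?A. jump_height v z)\<^sup>2 + (\<Sum>z\<in>?B. jump_height v z)\<^sup>2"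
    by (intro add_mono sq) auto
  also have "\<dots> \<le> (v x - v a)\<^sup>2 + (v b - v x)\<^sup>2"
  proof (intro add_mono power_mono nn)
    show "(\<Sum>z\<in>?A. jump_height v z) \<le> v x - v a" "(\<Sum>z\<in>?B. jump_height v z) \<le> v b - v x"
      by (rule sum_jump_height_le; use F x(1) jump_set_subset in auto)+
  qed auto
  finally show ?thesis .
qed

lemma jump_height_square_summable: "(\<lambda>z. (jump_height v z)\<^sup>2) summable_on jump_set a b v"
proof (rule nonneg_bdd_above_summable_on)
  have a: "a \<notin> jump_set a b v" using jump_set_subset by auto
  show "bdd_above (sum (\<lambda>z. (jump_height v z)\<^sup>2) ` {F. F \<subseteq> jump_set a b v \<and> finite F})"
    using sum_jump_height_square_le[OF _ a] ab
    by (intro bdd_aboveI2[where M = "(v a - v a)\<^sup>2 + (v b - v a)\<^sup>2"]) auto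
qed auto

text \<open>Off the jumps, the jumps to the left of \<open>x\<close> and those to its right fit into the two
  increments \<open>v x - v a\<close> and \<open>v b - v x\<close> separately.\<close>

lemma two_increments_le:
  assumes "x \<in> {a..b}" "x \<notin> jump_set a b v"
  shows "2 * ((v x - v a) * (v b - v x))
    \<le> (v b - v a)\<^sup>2 - (\<Sum>\<^sub>\<infinity>z\<in>jump_set a b v. (jump_height v z)\<^sup>2)"
proof -
  have "(\<Sum>\<^sub>\<infinity>z\<in>jump_set a b v. (jump_height v z)\<^sup>2) \<le> (v x - v a)\<^sup>2 + (v b - v x)\<^sup>2"
    using sum_jump_height_square_le[OF assms] by (intro infsum_le_finite_sums jump_height_square_summable) auto
  then show ?thesis by (simp add: power2_eq_square algebra_simps)
qed

section \<open>The generalized inverse of \<open>v\<close>\<close>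

definition quantile :: "real \<Rightarrow> real" where "quantile t = Inf {x \<in> {a..b}. t < v x}"

lemma quantile_le:
  assumes "x \<in> {a..b}" "t < v x"
  shows "quantile t \<le> x"
  unfolding quantile_def by (rule cInf_lower) (use assms in \<open>auto intro!: bdd_belowI[where m = a]\<close>)

lemma le_quantile:
  assumes "t < v b" "\<And>x. x \<in> {a..b} \<Longrightarrow> t < v x \<Longrightarrow> y \<le> x"
  shows "y \<le> quantile t"
  unfolding quantile_def by (rule cInf_greatest) (use assms ab in auto)

text \<open>Together with \<open>less_quantile_D\<close>: \<open>quantile t\<close> separates the
  points where v \<le> t from those where v > t. Nothing is said about the point
  \<open>quantile t\<close> itself, which later arguments discard as a null set.\<close>

lemma quantile_less_D:
  assumes "t < v b" "quantile t < x" "x \<le> b"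
  shows "t < v x"
proof (rule ccontr)
  assume nt: "\<not> t < v x"
  have "a \<le> quantile t" using assms by (intro le_quantile) auto
  moreover have "x \<le> quantile t"
  proof (rule le_quantile[OF assms(1)])
    fix y assume y: "y \<in> {a..b}" "t < v y"
    show "x \<le> y"
    proof (rule ccontr)
      assume "\<not> x \<le> y"
      then have "v y \<le> v x" using y assms by (intro le) auto
      then show False using nt y by simp
    qed
  qed
  ultimately show False using assms by simp
qed

lemma less_quantile_D:
  assumes "a \<le> x" "x < quantile t" "x \<le> b"
  shows "v x \<le> t"
  using quantile_le[of x t] assms by fastforce

text \<open>Here continuity of \<open>v\<close> at the endpoints enters. It keeps the crossing
  points inside the open interval, so the steps jump there and Dv loses no mass at the
  boundary.\<close>

lemma quantile_in:
  assumes "t \<in> {v a<..<v b}"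
  shows "quantile t \<in> {a<..<b}"
proof -
  have "eventually (\<lambda>x. v x < t) (at a within {a..b})"
    using cont_a assms unfolding continuous_within by (auto intro: order_tendstoD)
  then obtain d where d: "d > 0" "\<And>x. x \<in> {a..b} \<Longrightarrow> x \<noteq> a \<Longrightarrow> dist x a < d \<Longrightarrow> v x < t"
    unfolding eventually_at by blast
  have "a + d \<le> quantile t"
  proof (rule le_quantile)
    fix x assume x: "x \<in> {a..b}" "t < v x"
    then have "x \<noteq> a" using assms by auto
    then show "a + d \<le> x" using d(2)[of x] x by (force simp: dist_real_def)
  qed (use assms in auto)
  moreover have "eventually (\<lambda>x. t < v x) (at b within {a..b})"
    using cont_b assms unfolding continuous_within by (auto intro: order_tendstoD)
  then obtain e where e: "e > 0" "\<And>x. x \<in> {a..b} \<Longrightarrow> x \<noteq> b \<Longrightarrow> dist x b < e \<Longrightarrow> t < v x"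
    unfolding eventually_at by blast
  define x where "x = max a (b - e / 2)"
  have x: "x \<in> {a..b}" "x < b" "dist x b < e" using e(1) ab unfolding x_def by (auto simp: dist_real_def)
  then have "quantile t \<le> x" using e(2)[of x] by (intro quantile_le) auto
  ultimately show ?thesis using d(1) x by auto
qed

lemma quantile_mono: "mono_on {v a<..<v b} quantile"
proof (rule mono_onI)
  fix s t assume st: "s \<in> {v a<..<v b}" "t \<in> {v a<..<v b}" "s \<le> t"
  then show "quantile s \<le> quantile t"
    by (intro le_quantile quantile_le) auto
qed

text \<open>A jump of \<open>v\<close> is a flat piece of its inverse. With
  \<open>lim_left_le_quantile\<close> as converse, the levels crossed at \<open>z\<close> fill the
  interval between the one-sided limits up to its ends, so their measure is the jump height.\<close>

lemma quantile_eqI: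
  assumes z: "z \<in> {a<..<b}" and t: "lim_left z < t" "t < lim_right z"
  shows "quantile t = z"
proof (rule antisym)
  have tb: "t < v b" using t lim_bounds[of z] z by auto
  show "z \<le> quantile t"
  proof (rule le_quantile[OF tb], rule ccontr)
    fix x assume "x \<in> {a..b}" "t < v x" "\<not> z \<le> x"
    then show False using le_lim_left[of x z] z t by auto
  qed
  show "quantile t \<le> z"
  proof (rule dense_ge_bounded)
    show "z < b" using z by simp
    fix x assume "z < x" "x < b"
    then show "quantile t \<le> x" using lim_right_le[of z x] z t by (intro quantile_le) auto
  qed
qed

lemma lim_left_le_quantile:
  assumes t: "t \<in> {v a<..<v b}"
  shows "lim_left (quantile t) \<le> t" "t \<le> lim_right (quantile t)"
proof -
  let ?z = "quantile t"
  have z: "a < ?z" "?z < b" using quantile_in[OF t] by auto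
  show "lim_left ?z \<le> t"
    unfolding lim_left_def by (rule cSUP_least) (use z less_quantile_D in auto)
  show "t \<le> lim_right ?z"
    unfolding lim_right_def
    by (rule cINF_greatest) (use z t quantile_less_D in \<open>auto intro: less_imp_le\<close>)
qed

text \<open>The derivative of \<open>v\<close> is the image of Lebesgue measure on the range of values under the
  generalized inverse of \<open>v\<close>.\<close>

definition deriv_measure :: "real measure" where
  "deriv_measure = distr (restrict_space lborel {v a<..<v b}) (restrict_space borel {a<..<b}) quantile"

lemma quantile_measurable:
  "quantile \<in> measurable (restrict_space lborel {v a<..<v b}) (restrict_space borel {a<..<b})"
proof (rule measurable_restrict_space2)
  have "quantile \<in> borel_measurable (restrict_space borel {v a<..<v b})"
    using quantile_mono by (rule borel_measurable_mono_on_fnc)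
  moreover have "sets (restrict_space lborel {v a<..<v b}) = sets (restrict_space borel {v a<..<v b})"
    by (rule sets_restrict_space_cong) simp
  ultimately show "quantile \<in> borel_measurable (restrict_space lborel {v a<..<v b})"
    using measurable_cong_sets by blast
qed (use quantile_in in \<open>auto simp: space_restrict_space\<close>)

lemma emeasure_deriv_measure:
  assumes "X \<in> sets (restrict_space borel {a<..<b})"
  shows "emeasure deriv_measure X = emeasure lborel {t \<in> {v a<..<v b}. quantile t \<in> X}"
proof -
  have "quantile -` X \<inter> space (restrict_space lborel {v a<..<v b}) = {t \<in> {v a<..<v b}. quantile t \<in> X}"
    by (auto simp: space_restrict_space)
  then show ?thesis unfolding deriv_measure_def emeasure_distr[OF quantile_measurable assms]
    by (simp only:) (rule emeasure_restrict_space; auto)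
qed

lemma sets_deriv_measure [simp]: "sets deriv_measure = sets (restrict_space borel {a<..<b})"
  unfolding deriv_measure_def by simp

lemma emeasure_deriv_measure_whole: "emeasure deriv_measure {a<..<b} = ennreal (v b - v a)"
proof -
  have "{t \<in> {v a<..<v b}. quantile t \<in> {a<..<b}} = {v a<..<v b}" using quantile_in by blast
  then show ?thesis using emeasure_deriv_measure[of "{a<..<b}"] le[of a b] ab
    by (simp add: sets_restrict_space_iff)
qed

lemma finite_deriv_measure: "finite_measure deriv_measure"
  by (rule finite_measureI)
    (simp add: emeasure_deriv_measure_whole sets_eq_imp_space_eq[OF sets_deriv_measure])

lemma emeasure_deriv_measure_singleton:
  assumes z: "z \<in> {a<..<b}"
  shows "emeasure deriv_measure {z} = ennreal (jump_height v z)"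
proof -
  let ?X = "{t \<in> {v a<..<v b}. quantile t = z}"
  have X: "?X \<in> sets lborel"
  proof -
    have "quantile -` {z} \<inter> space (restrict_space lborel {v a<..<v b}) \<in> sets (restrict_space lborel {v a<..<v b})"
      by (rule measurable_sets[OF quantile_measurable]) (use z in \<open>simp add: sets_restrict_space_iff\<close>)
    moreover have "quantile -` {z} \<inter> space (restrict_space lborel {v a<..<v b}) = ?X"
      by (auto simp: space_restrict_space)
    ultimately show ?thesis by (simp add: sets_restrict_space_iff)
  qed
  have bounds: "v a \<le> lim_left z" "lim_right z \<le> v b" "lim_left z \<le> lim_right z"
    using lim_bounds[of z] lim_left_le_lim_right[of z] z by auto
  have "emeasure lborel {lim_left z<..<lim_right z} \<le> emeasure lborel ?X"
    by (rule emeasure_mono[OF _ X]) (use bounds quantile_eqI[OF z] in auto)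
  moreover have "emeasure lborel ?X \<le> emeasure lborel {lim_left z..lim_right z}"
    using lim_left_le_quantile by (intro emeasure_mono) auto
  ultimately have "emeasure lborel ?X = ennreal (lim_right z - lim_left z)"
    using bounds by (intro antisym) simp_all
  then show ?thesis using emeasure_deriv_measure[of "{z}"] z
    by (simp add: sets_restrict_space_iff jump_height_eq)
qed

lemma emeasure_deriv_measure_jumps:
  "emeasure deriv_measure (jump_set a b v) = ennreal (\<Sum>\<^sub>\<infinity>z\<in>jump_set a b v. jump_height v z)"
proof -
  have abs: "Infinite_Set_Sum.abs_summable_on (jump_height v) (jump_set a b v)"
    using jump_height_summable abs_summable_equivalent[of "jump_height v"]
      summable_on_iff_abs_summable_on_real[of "jump_height v"] by blast
  have "emeasure deriv_measure (jump_set a b v)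
    = (\<integral>\<^sup>+z. emeasure deriv_measure {z} \<partial>count_space (jump_set a b v))"
    using countable_jump_set jump_set_subset
    by (intro emeasure_countable_singleton) (auto simp: sets_restrict_space_iff)
  also have "\<dots> = (\<integral>\<^sup>+z. ennreal (jump_height v z) \<partial>count_space (jump_set a b v))"
    using jump_set_subset by (intro nn_integral_cong emeasure_deriv_measure_singleton) auto
  also have "\<dots> = ennreal (\<Sum>\<^sub>\<infinity>z\<in>jump_set a b v. jump_height v z)"
    using abs jump_height_pos
    by (simp add: nn_integral_conv_infsetsum infsetsum_infsum less_imp_le)
  finally show ?thesis .
qed

lemma emeasure_deriv_measure_diffuse:
  "emeasure deriv_measure ({a<..<b} - jump_set a b v)
    = ennreal (v b - v a - (\<Sum>\<^sub>\<infinity>z\<in>jump_set a b v. jump_height v z))"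
proof -
  interpret finite_measure deriv_measure by (rule finite_deriv_measure)
  have "jump_set a b v \<in> sets deriv_measure"
    using jump_set_subset
    by (intro sets.countable[OF _ countable_jump_set]) (auto simp: sets_restrict_space_iff)
  then have "emeasure deriv_measure ({a<..<b} - jump_set a b v)
    = emeasure deriv_measure {a<..<b} - emeasure deriv_measure (jump_set a b v)"
    using jump_set_subset by (intro emeasure_Diff) (auto simp: sets_restrict_space_iff)
  also have "\<dots> = ennreal (v b - v a - (\<Sum>\<^sub>\<infinity>z\<in>jump_set a b v. jump_height v z))"
    unfolding emeasure_deriv_measure_whole emeasure_deriv_measure_jumps
    using jump_height_pos by (intro ennreal_minus infsum_nonneg) (auto intro: less_imp_le)
  finally show ?thesis .
qed

text \<open>Layer-cake formula and Fubini: v x - v a is the measure of the levels t in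
  \<open>{v a<..<v b}\<close> with t < v x. For fixed t the derivative of \<phi> is integrated from
  \<open>quantile t\<close> to \<open>b\<close>, where \<phi> vanishes, which leaves
  \<open>- \<phi> (quantile t)\<close>.\<close>

lemma integral_by_quantile:
  assumes \<phi>: "test_fun a b \<phi>"
  shows "(LINT x:{a<..<b}|lebesgue. v x * deriv \<phi> x) = - (\<integral>x. \<phi> x \<partial>deriv_measure)"
proof -
  let ?O = "{a<..<b}" and ?T = "{v a<..<v b}"
  obtain D where D: "\<And>x. (\<phi> has_real_derivative D x) (at x)" "continuous_on UNIV D"
    using \<phi> unfolding test_fun_def C1_differentiable_real_iff by blast
  have [measurable]: "D \<in> borel_measurable borel"
    using D(2) by (rule borel_measurable_continuous_onI)
  have [measurable]: "\<phi> \<in> borel_measurable borel"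
    using test_fun_continuous[OF \<phi>] by (rule borel_measurable_continuous_onI)
  have deriv: "deriv \<phi> x = D x" for x using D(1) by (rule DERIV_imp_deriv)
  have "compact (D ` {a..b})"
    using D(2) by (intro compact_continuous_image) (auto intro: continuous_on_subset)
  then obtain B where "\<forall>y\<in>D ` {a..b}. norm y \<le> B"
    using compact_imp_bounded bounded_iff by metis
  then have B: "\<bar>D x\<bar> \<le> B" if "x \<in> {a..b}" for x using that by auto
  have FTC: "(\<integral>x. indicator {p..b} x * D x \<partial>lborel) = - \<phi> p" if "a \<le> p" "p \<le> b" for p
  proof -
    have "(\<integral>x. indicator {p..b} x *\<^sub>R D x \<partial>lborel) = \<phi> b - \<phi> p"
      using D that
      by (intro integral_FTC_Icc)
        (auto intro: has_field_derivative_at_within continuous_on_subset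
          simp flip: has_real_derivative_iff_has_vector_derivative)
    then show ?thesis using test_fun_eq_0[OF \<phi>, of b] by simp
  qed
  have ae: "AE x in lborel. x \<noteq> (c :: real)" for c by (rule AE_lborel_singleton)
  define F where "F x t = indicator ?O x * indicator ?T t * (indicator {t<..} (V x) * D x)" for x t
  have F_meas [measurable]: "case_prod F \<in> borel_measurable (lborel \<Otimes>\<^sub>M lborel)"
  proof -
    have [measurable]: "(\<lambda>p. indicator {snd p<..} (V (fst p)) :: real) \<in> borel_measurable (lborel \<Otimes>\<^sub>M lborel)"
    proof -
      have "(\<lambda>p. indicator {snd p<..} (V (fst p)) :: real) = indicator {p. snd p < V (fst p)}"
        by (auto simp: fun_eq_iff indicator_def)
      then show ?thesis by simp
    qed
    show ?thesis unfolding F_def case_prod_beta by measurable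
  qed
  have "integrable (lborel \<Otimes>\<^sub>M lborel) (\<lambda>p. B * indicator (?O \<times> ?T) p)"
    by (intro integrable_mult_right integrable_real_indicator)
      (use ab le[of a b] in \<open>auto simp: lborel.emeasure_pair_measure_Times ennreal_mult_less_top\<close>)
  then have F_int: "integrable (lborel \<Otimes>\<^sub>M lborel) (case_prod F)"
  proof (rule Bochner_Integration.integrable_bound[OF _ F_meas], intro AE_I2)
    fix p :: "real \<times> real"
    show "norm (case_prod F p) \<le> norm (B * indicator (?O \<times> ?T) p)"
      using B[of "fst p"] unfolding F_def by (auto simp: indicator_def split: prod.splits)
  qed
  have inner_t: "(\<integral>t. F x t \<partial>lborel) = indicator ?O x * ((V x - v a) * D x)" for x
  proof -
    have "F x t = indicator ?O x * D x * indicator {v a<..<V x} t" for t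
      using V_bounds[of x] unfolding F_def by (auto simp: indicator_def)
    then show ?thesis using V_bounds[of x] by simp
  qed
  have inner_x: "(\<integral>x. F x t \<partial>lborel) = indicator ?T t * - \<phi> (quantile t)" for t
  proof (cases "t \<in> ?T")
    case True
    have q: "quantile t \<in> ?O" using True by (rule quantile_in)
    \<comment> \<open>The integrands can differ only at \<open>quantile t\<close>, where
      \<open>v\<close> is not compared with \<open>t\<close>, and at \<open>b\<close>, which the
      open interval omits.\<close>
    have "(\<integral>x. F x t \<partial>lborel) = (\<integral>x. indicator {quantile t..b} x * D x \<partial>lborel)"
    proof (rule integral_cong_AE)
      show "AE x in lborel. F x t = indicator {quantile t..b} x * D x"
        using ae[of "quantile t"] ae[of b]
      proof eventually_elim
        case (elim x)
        then show ?case
          using q True quantile_less_D[of t x] less_quantile_D[of x t] V_eq[of x] unfolding F_def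
          by (auto simp: indicator_def)
      qed
    next
      have "(\<lambda>x. indicator {t<..} (V x) :: real) \<in> borel_measurable lborel" by measurable
      then show "(\<lambda>x. F x t) \<in> borel_measurable lborel" unfolding F_def by measurable
    qed measurable
    then show ?thesis using FTC q True by simp
  qed (simp add: F_def)
  \<comment> \<open>Disposes of the constant \<open>v a\<close> that the layer-cake formula
    subtracts from \<open>v\<close>.\<close>
  have FO: "(\<integral>x. indicator ?O x * D x \<partial>lborel) = 0"
  proof -
    have "(\<integral>x. indicator ?O x * D x \<partial>lborel) = (\<integral>x. indicator {a..b} x * D x \<partial>lborel)"
      using ae[of a] ae[of b] by (intro integral_cong_AE) (auto simp: indicator_def)
    then show ?thesis using FTC[of a] ab test_fun_eq_0[OF \<phi>, of a] by simp
  qed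
  have O_int: "integrable lborel (\<lambda>x. indicator ?O x * D x)"
  proof (rule Bochner_Integration.integrable_bound[of _ "\<lambda>x. B * indicator ?O x"])
    show "AE x in lborel. norm (indicator ?O x * D x) \<le> norm (B * indicator ?O x)"
    proof (intro AE_I2)
      fix x show "norm (indicator ?O x * D x) \<le> norm (B * indicator ?O x)"
        using B[of x] by (auto simp: indicator_def)
    qed
    show "integrable lborel (\<lambda>x. B * indicator ?O x)"
      by (intro integrable_mult_right integrable_real_indicator) (use ab in auto)
  qed auto
  have Fx_int: "integrable lborel (\<lambda>x. indicator ?O x * ((V x - v a) * D x))"
    using lborel_pair.integrable_fst'[OF F_int] by (simp add: inner_t)
  have "(LINT x:?O|lebesgue. v x * deriv \<phi> x) = (\<integral>x. indicator ?O x * (V x * D x) \<partial>lebesgue)"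
    unfolding set_lebesgue_integral_def deriv
    by (intro Bochner_Integration.integral_cong) (auto simp: indicator_def V_eq)
  also have "\<dots> = (\<integral>x. indicator ?O x * (V x * D x) \<partial>lborel)"
    by (rule integral_completion) measurable
  also have "\<dots> = (\<integral>x. indicator ?O x * ((V x - v a) * D x) + v a * (indicator ?O x * D x) \<partial>lborel)"
    by (intro Bochner_Integration.integral_cong) (auto simp: algebra_simps)
  also have "\<dots> = (\<integral>x. indicator ?O x * ((V x - v a) * D x) \<partial>lborel)"
    using Fx_int O_int FO by simp
  also have "\<dots> = (\<integral>t. indicator ?T t * - \<phi> (quantile t) \<partial>lborel)"
    using lborel_pair.Fubini_integral[OF F_int] by (simp add: inner_t inner_x)
  also have "\<dots> = - (\<integral>t. indicator ?T t * \<phi> (quantile t) \<partial>lborel)" by simp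
  also have "(\<integral>t. indicator ?T t * \<phi> (quantile t) \<partial>lborel) = (\<integral>x. \<phi> x \<partial>deriv_measure)"
  proof -
    have "\<phi> \<in> borel_measurable (restrict_space borel ?O)" by (rule measurable_restrict_space1) measurable
    then show ?thesis unfolding deriv_measure_def
      by (simp add: integral_distr[OF quantile_measurable] integral_restrict_space)
  qed
  finally show ?thesis .
qed

lemma has_derivative_measure_deriv_measure:
  "has_derivative_measure a b v (deriv_measure, null_measure (restrict_space borel {a<..<b}))"
  unfolding has_derivative_measure_def
  using finite_deriv_measure integral_by_quantile sets.top[of deriv_measure]
  by (auto simp: integral_null_measure intro!: finite_measureI bexI[of _ "space deriv_measure"])

section \<open>Evaluation of \<open>TV_K\<close> at a non-decreasing function\<close>

lemma in_BV: "v \<in> BV a b"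
proof -
  have "integrable lborel (\<lambda>x. indicator {a<..<b} x * V x)"
  proof (rule Bochner_Integration.integrable_bound[of _ "\<lambda>x. (\<bar>v a\<bar> + \<bar>v b\<bar>) * indicator {a<..<b} x"])
    show "AE x in lborel. norm (indicator {a<..<b} x * V x) \<le> norm ((\<bar>v a\<bar> + \<bar>v b\<bar>) * indicator {a<..<b} x)"
    proof (intro AE_I2)
      fix x show "norm (indicator {a<..<b} x * V x) \<le> norm ((\<bar>v a\<bar> + \<bar>v b\<bar>) * indicator {a<..<b} x)"
        using V_bounds[of x] by (auto simp: indicator_def)
    qed
    show "integrable lborel (\<lambda>x. (\<bar>v a\<bar> + \<bar>v b\<bar>) * indicator {a<..<b} x)"
      by (intro integrable_mult_right integrable_real_indicator) (use ab in auto)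
  qed auto
  then have "integrable lebesgue (\<lambda>x. indicator {a<..<b} x * V x)"
    by (subst integrable_completion) auto
  then have "set_integrable lebesgue {a<..<b} v"
    unfolding set_integrable_def
    by (rule Bochner_Integration.integrable_cong[THEN iffD1, rotated 2]) (auto simp: indicator_def V_eq)
  then show ?thesis unfolding BV_def using has_derivative_measure_deriv_measure by blast
qed

lemma TV_K_eq:
  "TV_K K a b v = ennreal (v b - v a - (\<Sum>\<^sub>\<infinity>z\<in>jump_set a b v. jump_height v z))
    + (\<Sum>\<^sub>\<infinity>z\<in>jump_set a b v. ennreal (K (jump_height v z)))"
proof -
  have "abs_derivative a b v X = emeasure deriv_measure X" for X
    unfolding abs_derivative_def derivative_measure_nonneg_eqI[OF has_derivative_measure_deriv_measure] by simp
  moreover have "(\<Sum>\<^sub>\<infinity>z\<in>jump_set a b v. ennreal (K \<bar>Lim (ess_right z) v - Lim (ess_left z) v\<bar>))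
      = (\<Sum>\<^sub>\<infinity>z\<in>jump_set a b v. ennreal (K (jump_height v z)))"
  proof (rule infsum_cong)
    fix z assume z: "z \<in> jump_set a b v"
    then have "z \<in> {a<..<b}" using jump_set_subset by blast
    then show "ennreal (K \<bar>Lim (ess_right z) v - Lim (ess_left z) v\<bar>) = ennreal (K (jump_height v z))"
      using jump_height_eq[of z] jump_height_pos[OF z] by simp
  qed
  ultimately show ?thesis
    unfolding TV_K_def using in_BV by (simp add: emeasure_deriv_measure_diffuse)
qed

end

section \<open>Averaging over the super-level sets\<close>

context nondecreasing
begin

text \<open>The function U_t of the overview, expressed by comparing \<open>v x\<close> with
  \<open>t\<close> instead of through the jump point: for fixed \<open>x\<close>, the dependence on
  the level is then explicit.\<close>

definition step_at_level :: "real \<Rightarrow> real \<Rightarrow> real" where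
  "step_at_level t x = (if t < v x then v b else v a)"

lemma step_at_level_below:
  assumes "t \<in> {v a<..<v b}" "a \<le> x" "x < quantile t"
  shows "step_at_level t x = v a"
  using less_quantile_D[of x t] quantile_in[OF assms(1)] assms unfolding step_at_level_def by auto

lemma step_at_level_above:
  assumes "t \<in> {v a<..<v b}" "quantile t < x" "x \<le> b"
  shows "step_at_level t x = v b"
  using quantile_less_D[of t x] assms unfolding step_at_level_def by auto

lemma step_at_level_ends:
  assumes "t \<in> {v a<..<v b}"
  shows "step_at_level t a = v a" "step_at_level t b = v b"
  using assms unfolding step_at_level_def by auto

lemma nondecreasing_step_at_level:
  assumes t: "t \<in> {v a<..<v b}"
  shows "nondecreasing a b (step_at_level t)"
proof
  show "a < b" by (rule ab)
  show "mono_on {a..b} (step_at_level t)"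
  proof (rule mono_onI)
    fix x y assume "x \<in> {a..b}" "y \<in> {a..b}" "x \<le> y"
    then show "step_at_level t x \<le> step_at_level t y"
      using le[of x y] t unfolding step_at_level_def by auto
  qed
  have q: "quantile t \<in> {a<..<b}" using t by (rule quantile_in)
  have "eventually (\<lambda>x. step_at_level t x = step_at_level t a) (at a within {a..b})"
    unfolding eventually_at
    by (intro exI[of _ "quantile t - a"])
      (use q step_at_level_below[OF t] step_at_level_ends[OF t] in \<open>auto simp: dist_real_def\<close>)
  then show "continuous (at a within {a..b}) (step_at_level t)"
    unfolding continuous_within by (rule tendsto_eventually)
  have "eventually (\<lambda>x. step_at_level t x = step_at_level t b) (at b within {a..b})"
    unfolding eventually_at
    by (intro exI[of _ "b - quantile t"])
      (use q step_at_level_above[OF t] step_at_level_ends[OF t] in \<open>auto simp: dist_real_def\<close>)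
  then show "continuous (at b within {a..b}) (step_at_level t)"
    unfolding continuous_within by (rule tendsto_eventually)
qed

lemma step_at_level_jump:
  assumes t: "t \<in> {v a<..<v b}"
  shows "jump_set a b (step_at_level t) = {quantile t}"
    and "jump_height (step_at_level t) (quantile t) = v b - v a"
proof -
  have q: "a < quantile t" "quantile t < b" using quantile_in[OF t] by auto
  have left_below: "(step_at_level t \<longlongrightarrow> v a) (at_left x)" if "a < x" "x \<le> quantile t" for x
    by (rule tendsto_left_const[of a]) (use that step_at_level_below[OF t] in auto)
  have left_above: "(step_at_level t \<longlongrightarrow> v b) (at_left x)" if "quantile t < x" "x < b" for x
    by (rule tendsto_left_const[of "quantile t"]) (use that step_at_level_above[OF t] in auto)
  have right_below: "(step_at_level t \<longlongrightarrow> v a) (at_right x)" if "a < x" "x < quantile t" for x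
    by (rule tendsto_right_const[of _ "quantile t"]) (use that step_at_level_below[OF t] in auto)
  have right_above: "(step_at_level t \<longlongrightarrow> v b) (at_right x)" if "quantile t \<le> x" "x < b" for x
    by (rule tendsto_right_const[of _ b]) (use that step_at_level_above[OF t] in auto)
  show "jump_height (step_at_level t) (quantile t) = v b - v a"
    using Lim_ess_diff(2)[OF left_below right_above] q by simp
  show "jump_set a b (step_at_level t) = {quantile t}"
  proof (intro set_eqI)
    fix x
    show "x \<in> jump_set a b (step_at_level t) \<longleftrightarrow> x \<in> {quantile t}"
    proof (cases "x \<in> {a<..<b}")
      case False
      then show ?thesis using q unfolding jump_set_def by auto
    next
      case True
      consider "x < quantile t" | "x = quantile t" | "x > quantile t" by linarith
      then show ?thesis
        using True t q jump_set_iff[OF left_below right_below, of x a b]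
          jump_set_iff[OF left_below right_above, of x a b] jump_set_iff[OF left_above right_above, of x a b]
        by cases auto
    qed
  qed
qed

lemma one_jump_competitor_step_at_level:
  assumes t: "t \<in> {v a<..<v b}" and g: "v a = g a" "v b = g b"
  shows "one_jump_competitor g a b (step_at_level t)"
proof -
  have "step_at_level t x = step_at_level t y"
    if xy: "x \<in> {a..b}" "y \<in> {a..b}" "x \<le> y" and disj: "{x..y} \<inter> {quantile t} = {}" for x y
  proof -
    have "y < quantile t \<or> quantile t < x" using xy disj by auto
    then show ?thesis using xy step_at_level_below[OF t] step_at_level_above[OF t] by auto
  qed
  then have "piecewise_constant a b (step_at_level t)"
    unfolding piecewise_constant_def using quantile_in[OF t] by (intro exI[of _ "{quantile t}"]) auto
  then show ?thesis
    unfolding one_jump_competitor_def using step_at_level_jump(1)[OF t] step_at_level_ends[OF t] g by simp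
qed

lemma TV_K_step_at_level:
  assumes t: "t \<in> {v a<..<v b}"
  shows "TV_K K a b (step_at_level t) = ennreal (K (v b - v a))"
  unfolding nondecreasing.TV_K_eq[OF nondecreasing_step_at_level[OF t]]
  by (simp add: step_at_level_jump[OF t] step_at_level_ends[OF t])

text \<open>The hypothesis on \<open>I\<close> is integrated over all levels and divided by the
  length of their range. In the application \<open>I\<close> is the energy of the minimizer,
  \<open>c\<close> the cost of one jump of full height and \<open>d\<close> the fidelity weight;
  \<open>h\<close> is a Borel substitute for \<open>g\<close> off the interval.\<close>

lemma average_step_at_level:
  fixes h g :: "real \<Rightarrow> real"
  assumes h [measurable]: "h \<in> borel_measurable borel" and hg: "\<And>x. x \<in> {a<..<b} \<Longrightarrow> h x = g x"
    and va_vb: "v a < v b"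
    and I: "\<And>t. t \<in> {v a<..<v b} \<Longrightarrow>
      I \<le> c + d * (\<integral>\<^sup>+x\<in>{a<..<b}. ennreal (\<bar>step_at_level t x - g x\<bar>\<^sup>2) \<partial>lebesgue)"
    and P: "P = (v b - v a)\<^sup>2 - (\<Sum>\<^sub>\<infinity>z\<in>jump_set a b v. (jump_height v z)\<^sup>2)"
  shows "I \<le> c + d * ((\<integral>\<^sup>+x\<in>{a<..<b}. ennreal (\<bar>v x - g x\<bar>\<^sup>2) \<partial>lebesgue) + ennreal ((b - a) * P / 2))"
proof -
  let ?O = "{a<..<b}" and ?T = "{v a<..<v b}"
  define \<rho> where "\<rho> = v b - v a"
  have \<rho>: "\<rho> > 0" using va_vb unfolding \<rho>_def by simp
  have P0: "P \<ge> 0"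
    using two_increments_le[of a] ab jump_set_subset unfolding P by force
  \<comment> \<open>Agrees with \<open>step_at_level\<close> on \<open>{a..b}\<close> and is jointly
    measurable in level and position.\<close>
  define W where "W t x = v a + \<rho> * indicator {t<..} (V x)" for t x
  have W_meas [measurable]: "(\<lambda>p. W (snd p) (fst p)) \<in> borel_measurable (lborel \<Otimes>\<^sub>M lborel)"
  proof -
    have [measurable]: "(\<lambda>p. indicator {snd p<..} (V (fst p)) :: real) \<in> borel_measurable (lborel \<Otimes>\<^sub>M lborel)"
    proof -
      have "(\<lambda>p. indicator {snd p<..} (V (fst p)) :: real) = indicator {p. snd p < V (fst p)}"
        by (auto simp: fun_eq_iff indicator_def)
      then show ?thesis by simp
    qed
    show ?thesis unfolding W_def by measurable
  qed
  define f where "f x t = ennreal ((W t x - h x)\<^sup>2) * indicator ?O x" for x t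
  have f_meas: "(\<lambda>(x, t). f x t * indicator ?T t) \<in> borel_measurable (lborel \<Otimes>\<^sub>M lborel)"
    unfolding f_def case_prod_beta by measurable
  define G where "G = (\<integral>\<^sup>+x. ennreal ((V x - h x)\<^sup>2) * indicator ?O x \<partial>lborel)"
  have \<Phi>: "(\<integral>\<^sup>+x\<in>?O. ennreal (\<bar>step_at_level t x - g x\<bar>\<^sup>2) \<partial>lebesgue) = (\<integral>\<^sup>+x. f x t \<partial>lborel)" for t
    unfolding nn_integral_completion
    by (intro nn_integral_cong) (auto simp: f_def W_def step_at_level_def \<rho>_def V_eq hg indicator_def)
  have G: "(\<integral>\<^sup>+x\<in>?O. ennreal (\<bar>v x - g x\<bar>\<^sup>2) \<partial>lebesgue) = G"
    unfolding nn_integral_completion G_def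
    by (intro nn_integral_cong) (auto simp: V_eq hg indicator_def)
  \<comment> \<open>At a fixed \<open>x\<close>, levels of total length \<open>V x - v a\<close>
    give the value \<open>v b\<close> and levels of length \<open>v b - V x\<close> give
    \<open>v a\<close>. The right-hand side is squared bias plus variance, times the length \<rho>
    of the range.\<close>
  have inner: "(\<integral>\<^sup>+t. f x t * indicator ?T t \<partial>lborel)
      = ennreal \<rho> * ennreal ((V x - h x)\<^sup>2 + (V x - v a) * (v b - V x)) * indicator ?O x" for x
  proof -
    have "(\<integral>\<^sup>+t. f x t * indicator ?T t \<partial>lborel)
      = (\<integral>\<^sup>+t. (ennreal ((v b - h x)\<^sup>2) * indicator {v a<..<V x} t
          + ennreal ((v a - h x)\<^sup>2) * indicator {max (V x) (v a)<..<v b} t) * indicator ?O x \<partial>lborel)"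
    proof (intro nn_integral_cong_AE)
      show "AE t in lborel. f x t * indicator ?T t = (ennreal ((v b - h x)\<^sup>2) * indicator {v a<..<V x} t
          + ennreal ((v a - h x)\<^sup>2) * indicator {max (V x) (v a)<..<v b} t) * indicator ?O x"
        using AE_lborel_singleton[of "V x"]
      proof eventually_elim
        case (elim t)
        then show ?case using V_bounds[of x] unfolding f_def W_def \<rho>_def
          by (auto simp: indicator_def)
      qed
    qed
    also have "\<dots> = (ennreal ((v b - h x)\<^sup>2) * ennreal (V x - v a)
        + ennreal ((v a - h x)\<^sup>2) * ennreal (v b - V x)) * indicator ?O x"
      using V_bounds[of x] by (simp add: nn_integral_multc nn_integral_add nn_integral_cmult max_absorb1)
    also have "ennreal ((v b - h x)\<^sup>2) * ennreal (V x - v a) + ennreal ((v a - h x)\<^sup>2) * ennreal (v b - V x)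
        = ennreal ((v b - h x)\<^sup>2 * (V x - v a) + (v a - h x)\<^sup>2 * (v b - V x))"
      using V_bounds[of x] by (simp add: ennreal_mult)
    also have "(v b - h x)\<^sup>2 * (V x - v a) + (v a - h x)\<^sup>2 * (v b - V x)
        = \<rho> * ((V x - h x)\<^sup>2 + (V x - v a) * (v b - V x))"
      unfolding \<rho>_def by (simp add: power2_eq_square algebra_simps)
    finally show ?thesis using \<rho> V_bounds[of x] by (simp add: ennreal_mult)
  qed
  have "(\<integral>\<^sup>+t. (\<integral>\<^sup>+x. f x t \<partial>lborel) * indicator ?T t \<partial>lborel)
      = (\<integral>\<^sup>+t. (\<integral>\<^sup>+x. f x t * indicator ?T t \<partial>lborel) \<partial>lborel)"
    by (intro nn_integral_cong) (simp add: indicator_def)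
  also have "\<dots> = (\<integral>\<^sup>+x. (\<integral>\<^sup>+t. f x t * indicator ?T t \<partial>lborel) \<partial>lborel)"
    using lborel_pair.Fubini'[OF f_meas] by simp
  also have "\<dots> \<le> (\<integral>\<^sup>+x. ennreal \<rho> * (ennreal ((V x - h x)\<^sup>2) * indicator ?O x + ennreal (P / 2) * indicator ?O x) \<partial>lborel)"
    unfolding inner
  proof (rule nn_integral_mono_AE)
    \<comment> \<open>Jump points are countable, so \<open>two_increments_le\<close> bounds the
      variance by \<open>P / 2\<close> almost everywhere.\<close>
    have "AE x in lborel. x \<notin> jump_set a b v"
      by (rule AE_not_in[OF countable_imp_null_set_lborel[OF countable_jump_set]])
    then show "AE x in lborel. ennreal \<rho> * ennreal ((V x - h x)\<^sup>2 + (V x - v a) * (v b - V x)) * indicator ?O x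
      \<le> ennreal \<rho> * (ennreal ((V x - h x)\<^sup>2) * indicator ?O x + ennreal (P / 2) * indicator ?O x)"
    proof eventually_elim
      case (elim x)
      show ?case
      proof (cases "x \<in> ?O")
        case True
        then have "(V x - v a) * (v b - V x) \<le> P / 2"
          using two_increments_le[OF _ elim] V_eq[of x] unfolding P by auto
        then have "ennreal ((V x - h x)\<^sup>2 + (V x - v a) * (v b - V x)) \<le> ennreal ((V x - h x)\<^sup>2) + ennreal (P / 2)"
          using P0 by (simp flip: ennreal_plus)
        then show ?thesis using True by (simp add: mult_left_mono)
      qed simp
    qed
  qed
  also have "\<dots> = ennreal \<rho> * (G + ennreal (P / 2) * emeasure lborel ?O)"
    unfolding G_def by (simp add: nn_integral_cmult nn_integral_add)
  also have "ennreal (P / 2) * emeasure lborel ?O = ennreal ((b - a) * P / 2)"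
    using ab P0 by (simp add: mult.commute flip: ennreal_mult)
  finally have avg: "(\<integral>\<^sup>+t. (\<integral>\<^sup>+x. f x t \<partial>lborel) * indicator ?T t \<partial>lborel)
    \<le> ennreal \<rho> * (G + ennreal ((b - a) * P / 2))" .
  have \<Phi>_meas [measurable]: "(\<lambda>t. \<integral>\<^sup>+x. f x t \<partial>lborel) \<in> borel_measurable lborel"
  proof (rule lborel.borel_measurable_nn_integral)
    have [measurable]: "(\<lambda>p. W (fst p) (snd p)) \<in> borel_measurable (lborel \<Otimes>\<^sub>M lborel)"
      using measurable_compose[OF measurable_pair_swap' W_meas] by (simp add: case_prod_beta)
    show "(\<lambda>(t, x). f x t) \<in> borel_measurable (lborel \<Otimes>\<^sub>M lborel)"
      unfolding f_def case_prod_beta by measurable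
  qed
  have "ennreal \<rho> * I = (\<integral>\<^sup>+t. I * indicator ?T t \<partial>lborel)"
    using va_vb unfolding \<rho>_def by (simp add: nn_integral_cmult mult.commute)
  also have "\<dots> \<le> (\<integral>\<^sup>+t. (c * indicator ?T t + d * ((\<integral>\<^sup>+x. f x t \<partial>lborel) * indicator ?T t)) \<partial>lborel)"
  proof (rule nn_integral_mono)
    fix t
    show "I * indicator ?T t \<le> c * indicator ?T t + d * ((\<integral>\<^sup>+x. f x t \<partial>lborel) * indicator ?T t)"
      using I[of t, unfolded \<Phi>] by (cases "t \<in> ?T") simp_all
  qed
  also have "\<dots> = ennreal \<rho> * c + d * (\<integral>\<^sup>+t. (\<integral>\<^sup>+x. f x t \<partial>lborel) * indicator ?T t \<partial>lborel)"
    using va_vb unfolding \<rho>_def by (simp add: nn_integral_add nn_integral_cmult mult.commute)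
  also have "\<dots> \<le> ennreal \<rho> * c + d * (ennreal \<rho> * (G + ennreal ((b - a) * P / 2)))"
    by (intro add_left_mono mult_left_mono avg) simp
  also have "\<dots> = ennreal \<rho> * (c + d * (G + ennreal ((b - a) * P / 2)))"
    by (simp add: distrib_left mult.left_commute)
  finally show ?thesis
    unfolding G using \<rho> by (subst (asm) ennreal_mult_le_mult_iff) auto
qed

end

section \<open>The deficit\<close>

lemma ennreal_infsum:
  fixes f :: "'a \<Rightarrow> real"
  assumes "f summable_on A" "\<And>x. x \<in> A \<Longrightarrow> f x \<ge> 0"
  shows "(\<Sum>\<^sub>\<infinity>x\<in>A. ennreal (f x)) = ennreal (infsum f A)"
proof -
  have "(\<Sum>\<^sub>\<infinity>x\<in>A. ennreal (f x)) = (SUP F\<in>{F. finite F \<and> F \<subseteq> A}. \<Sum>x\<in>F. ennreal (f x))"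
    by (rule nonneg_infsum_complete) simp
  also have "\<dots> = (SUP F\<in>{F. finite F \<and> F \<subseteq> A}. ennreal (sum f F))"
    using assms(2) by (intro SUP_cong) (auto intro!: sum_ennreal)
  finally show ?thesis using infsum_nonneg_is_SUPREMUM_ennreal[OF assms] by simp
qed

text \<open>With s the sum of the \<open>r z\<close>, the first two terms of \<open>Q\<close> equal
  the sum of the non-negative numbers \<open>r z * (s - r z)\<close>. If \<open>Q\<close> vanishes,
  then s = \<rho> and every non-zero \<open>r z\<close> equals s; such a term exists because \<rho>
  > 0. Conversely, a jump of height \<rho> makes the upper bound for \<open>Q\<close> non-positive.
  The gap between that bound and \<open>Q\<close> is 2 s (\<rho> - s).\<close>

lemma deficit:
  fixes r :: "'a \<Rightarrow> real"
  assumes r: "\<And>z. z \<in> J \<Longrightarrow> 0 \<le> r z" "r summable_on J" "(\<lambda>z. (r z)\<^sup>2) summable_on J"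
    and \<rho>: "0 < \<rho>" "infsum r J \<le> \<rho>"
    and Q: "Q = (infsum r J)\<^sup>2 - (\<Sum>\<^sub>\<infinity>z\<in>J. (r z)\<^sup>2) + (\<rho> - infsum r J)\<^sup>2"
  shows "Q \<ge> 0"
    and "Q \<le> \<rho>\<^sup>2 - (\<Sum>\<^sub>\<infinity>z\<in>J. (r z)\<^sup>2)"
    and "Q = 0 \<longleftrightarrow> (\<exists>z\<in>J. \<rho> = r z)"
proof -
  define s where "s = infsum r J"
  have s0: "0 \<le> s" unfolding s_def using r by (intro infsum_nonneg)
  have rs: "r z \<le> s" if "z \<in> J" for z
    using finite_sum_le_infsum[OF r(2), of "{z}"] r that unfolding s_def by auto
  have sr: "(\<lambda>z. s * r z) summable_on J" by (intro summable_on_cmult_right r)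
  have nn: "0 \<le> s * r z - (r z)\<^sup>2" if "z \<in> J" for z
    using rs[OF that] r(1)[OF that] by (simp add: power2_eq_square mult_right_mono)
  have d: "(\<lambda>z. s * r z - (r z)\<^sup>2) summable_on J"
    by (rule summable_on_comparison_test[OF sr]) (use nn in auto)
  have eq: "s\<^sup>2 - (\<Sum>\<^sub>\<infinity>z\<in>J. (r z)\<^sup>2) = (\<Sum>\<^sub>\<infinity>z\<in>J. s * r z - (r z)\<^sup>2)"
    using infsum_add[OF d r(3)] infsum_cmult_right[OF r(2), of s]
    by (simp add: s_def power2_eq_square)
  have "(\<Sum>\<^sub>\<infinity>z\<in>J. s * r z - (r z)\<^sup>2) \<ge> 0" by (intro infsum_nonneg nn)
  then have sq: "(\<Sum>\<^sub>\<infinity>z\<in>J. (r z)\<^sup>2) \<le> s\<^sup>2" using eq by simp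
  have Qs: "Q = s\<^sup>2 - (\<Sum>\<^sub>\<infinity>z\<in>J. (r z)\<^sup>2) + (\<rho> - s)\<^sup>2" using Q unfolding s_def .
  show Q0: "Q \<ge> 0" unfolding Qs using sq by simp
  have "0 \<le> s * (\<rho> - s)" using s0 \<rho> unfolding s_def by simp
  moreover have "\<rho>\<^sup>2 = s\<^sup>2 + (\<rho> - s)\<^sup>2 + 2 * (s * (\<rho> - s))" by (simp add: power2_eq_square algebra_simps)
  ultimately show Qle: "Q \<le> \<rho>\<^sup>2 - (\<Sum>\<^sub>\<infinity>z\<in>J. (r z)\<^sup>2)" unfolding Qs by simp
  show "Q = 0 \<longleftrightarrow> (\<exists>z\<in>J. \<rho> = r z)"
  proof
    assume "\<exists>z\<in>J. \<rho> = r z"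
    then obtain z where "z \<in> J" "\<rho> = r z" by blast
    then have "\<rho>\<^sup>2 \<le> (\<Sum>\<^sub>\<infinity>z\<in>J. (r z)\<^sup>2)"
      using finite_sum_le_infsum[OF r(3), of "{z}"] by auto
    then show "Q = 0" using Q0 Qle by simp
  next
    assume "Q = 0"
    then have "(\<rho> - s)\<^sup>2 = 0" and e0: "s\<^sup>2 - (\<Sum>\<^sub>\<infinity>z\<in>J. (r z)\<^sup>2) = 0"
      using sq zero_le_power2[of "\<rho> - s"] unfolding Qs by linarith+
    then have \<rho>s: "\<rho> = s" by simp
    have "\<exists>z\<in>J. r z \<noteq> 0"
    proof (rule ccontr)
      assume "\<not> ?thesis"
      then have "s = 0" unfolding s_def by (intro infsum_0) auto
      then show False using \<rho> \<rho>s by simp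
    qed
    then obtain z where z: "z \<in> J" "r z \<noteq> 0" by blast
    have "s * r z - (r z)\<^sup>2 \<le> 0"
      using finite_sum_le_infsum[OF d, of "{z}"] nn z e0 unfolding eq by auto
    then have "r z * (s - r z) \<le> 0" by (simp add: power2_eq_square algebra_simps)
    then have "s \<le> r z" using r(1)[OF z(1)] z(2) by (auto simp: mult_le_0_iff)
    then show "\<exists>z\<in>J. \<rho> = r z" using rs[OF z(1)] \<rho>s z by force
  qed
qed

section \<open>Combination of the jump and fidelity estimates\<close>

theorem lemma4p1:
  fixes \<alpha> \<beta> lam M C\<^sub>M :: real and K g U\<^sub>0 v :: "real \<Rightarrow> real"
  assumes "\<alpha> < \<beta>" and "lam > 0"
    and "\<And>\<rho>. \<rho> \<ge> 0 \<Longrightarrow> K \<rho> \<ge> 0"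
    and "K1 K" and "K2 K" and "K3 K"
    and "continuous_on {\<alpha>..\<beta>} g" and "mono_on {\<alpha>..\<beta>} g"
    and "M > 0" and "g \<beta> - g \<alpha> \<le> M" and "K2_const K M C\<^sub>M"
    and "is_arg_min (TV_Kg K lam g \<alpha> \<beta>) (one_jump_competitor g \<alpha> \<beta>) U\<^sub>0"
    and "C\<^sub>M - lam * (\<beta> - \<alpha>) / 2 > 0"
    and "mono_on {\<alpha>..\<beta>} v"
    and "continuous (at \<alpha> within {\<alpha>..\<beta>}) v" and "continuous (at \<beta> within {\<alpha>..\<beta>}) v"
    and "v \<alpha> = g \<alpha>" and "v \<beta> = g \<beta>"
  shows "let C = C\<^sub>M - lam * (\<beta> - \<alpha>) / 2;
             \<rho> = g \<beta> - g \<alpha>;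
             J = jump_set \<alpha> \<beta> v;
             r = jump_height v;
             Q = (\<Sum>\<^sub>\<infinity>z\<in>J. r z)\<^sup>2 - (\<Sum>\<^sub>\<infinity>z\<in>J. (r z)\<^sup>2) + (\<rho> - (\<Sum>\<^sub>\<infinity>z\<in>J. r z))\<^sup>2
         in countable J \<and> (\<forall>z\<in>J. r z > 0) \<and>
            r summable_on J \<and> (\<lambda>z. (r z)\<^sup>2) summable_on J \<and>
            TV_Kg K lam g \<alpha> \<beta> v \<ge> ennreal (C / 2 * Q) + TV_Kg K lam g \<alpha> \<beta> U\<^sub>0 \<and>
            Q \<ge> 0 \<and> (Q = 0 \<longleftrightarrow> (\<exists>z\<in>J. \<rho> = r z))"
proof -
  interpret v: nondecreasing \<alpha> \<beta> v by standard (fact assms)+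
  define J r where "J = jump_set \<alpha> \<beta> v" and "r = jump_height v"
  define C \<rho> where "C = C\<^sub>M - lam * (\<beta> - \<alpha>) / 2" and "\<rho> = g \<beta> - g \<alpha>"
  define Q where "Q = (\<Sum>\<^sub>\<infinity>z\<in>J. r z)\<^sup>2 - (\<Sum>\<^sub>\<infinity>z\<in>J. (r z)\<^sup>2) + (\<rho> - (\<Sum>\<^sub>\<infinity>z\<in>J. r z))\<^sup>2"
  define P where "P = \<rho>\<^sup>2 - (\<Sum>\<^sub>\<infinity>z\<in>J. (r z)\<^sup>2)"
  have U\<^sub>0: "one_jump_competitor g \<alpha> \<beta> U\<^sub>0"
    and U\<^sub>0_min: "\<And>U. one_jump_competitor g \<alpha> \<beta> U \<Longrightarrow> TV_Kg K lam g \<alpha> \<beta> U\<^sub>0 \<le> TV_Kg K lam g \<alpha> \<beta> U"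
    using assms(12) unfolding is_arg_min_def by (auto simp: not_less)
  have \<rho>_v: "\<rho> = v \<beta> - v \<alpha>" unfolding \<rho>_def using assms by simp
  have \<rho>: "\<rho> > 0"
    using one_jump_competitor_endpoints_neq[OF U\<^sub>0] v.le[of \<alpha> \<beta>] assms unfolding \<rho>_def by auto
  have r_pos: "\<And>z. z \<in> J \<Longrightarrow> 0 < r z" and r_sum: "r summable_on J" and r2_sum: "(\<lambda>z. (r z)\<^sup>2) summable_on J"
    and r_le: "infsum r J \<le> \<rho>"
    unfolding J_def r_def \<rho>_v
    by (fact v.jump_height_pos v.jump_height_summable v.jump_height_square_summable v.infsum_jump_height_le)+
  have r_nn: "0 \<le> r z" if "z \<in> J" for z using r_pos[OF that] by simp
  have Q: "Q \<ge> 0" "Q \<le> \<rho>\<^sup>2 - (\<Sum>\<^sub>\<infinity>z\<in>J. (r z)\<^sup>2)" "Q = 0 \<longleftrightarrow> (\<exists>z\<in>J. \<rho> = r z)"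
    by (rule deficit[OF _ r_sum r2_sum \<rho> r_le Q_def], erule r_nn)+
  have P0: "P \<ge> 0" using Q unfolding P_def by simp
  have K0: "K 0 = 0" using assms(4) unfolding K1_def by simp
  have "\<rho> \<le> M" using assms unfolding \<rho>_def by simp
  note KJ = K_jump_bound[OF assms(11) K0 assms(6) assms(3) r_nn r_sum r2_sum r_le this, simplified]
  let ?I = "\<lambda>u. \<integral>\<^sup>+x\<in>{\<alpha><..<\<beta>}. ennreal (\<bar>u x - g x\<bar>\<^sup>2) \<partial>lebesgue"

  have "TV_K K \<alpha> \<beta> v = ennreal (\<rho> - infsum r J) + ennreal (\<Sum>\<^sub>\<infinity>z\<in>J. K (r z))"
    unfolding v.TV_K_eq \<rho>_v J_def[symmetric] r_def[symmetric]
    using ennreal_infsum[OF KJ(1)] r_nn assms(3) by simp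
  also have "\<dots> = ennreal (\<rho> - infsum r J + (\<Sum>\<^sub>\<infinity>z\<in>J. K (r z)))"
    using r_le r_nn assms(3) by (intro ennreal_plus[symmetric] infsum_nonneg) auto
  also have "\<dots> \<ge> ennreal (K \<rho> + C\<^sub>M / 2 * P)"
    unfolding P_def using KJ(2) by (intro ennreal_leI) simp
  finally have TV_v: "ennreal (K \<rho> + C\<^sub>M / 2 * P) \<le> TV_K K \<alpha> \<beta> v" .

  \<comment> \<open>Clamping the argument turns the monotone \<open>g\<close> into a Borel function
    on the line, as the averaging requires.\<close>
  define h where "h x = g (max \<alpha> (min \<beta> x))" for x
  have "h \<in> borel_measurable borel"
    unfolding h_def using assms(1,8)
    by (intro borel_measurable_mono monoI) (auto intro!: mono_onD[OF assms(8)])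
  moreover have "h x = g x" if "x \<in> {\<alpha><..<\<beta>}" for x using that unfolding h_def by simp
  moreover have "TV_Kg K lam g \<alpha> \<beta> U\<^sub>0 \<le> ennreal (K \<rho>) + ennreal (lam / 2) * ?I (v.step_at_level t)"
    if t: "t \<in> {v \<alpha><..<v \<beta>}" for t
    using U\<^sub>0_min[OF v.one_jump_competitor_step_at_level[OF t assms(17,18)]]
    unfolding TV_Kg_def v.TV_K_step_at_level[OF t] \<rho>_v .
  ultimately have "TV_Kg K lam g \<alpha> \<beta> U\<^sub>0
      \<le> ennreal (K \<rho>) + ennreal (lam / 2) * (?I v + ennreal ((\<beta> - \<alpha>) * P / 2))"
    using \<rho> unfolding \<rho>_v P_def J_def r_def by (intro v.average_step_at_level[where h = h]) auto
  \<comment> \<open>Replacing \<open>Q\<close> by the larger \<open>P\<close> keeps the direction of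
    the inequality because C_* > 0.\<close>
  then have "ennreal (C / 2 * Q) + TV_Kg K lam g \<alpha> \<beta> U\<^sub>0
      \<le> ennreal (C / 2 * P) + (ennreal (K \<rho>) + ennreal (lam / 2) * (?I v + ennreal ((\<beta> - \<alpha>) * P / 2)))"
    using Q(2) assms(13) unfolding P_def C_def
    by (intro add_mono ennreal_leI mult_left_mono) auto
  also have "\<dots> = (ennreal (C / 2 * P) + ennreal (K \<rho>) + ennreal (lam / 2 * ((\<beta> - \<alpha>) * P / 2)))
      + ennreal (lam / 2) * ?I v"
    using ennreal_mult[of "lam / 2" "(\<beta> - \<alpha>) * P / 2"] assms(1,2) P0 by (simp only: distrib_left) (simp add: ac_simps)
  also have "ennreal (C / 2 * P) + ennreal (K \<rho>) + ennreal (lam / 2 * ((\<beta> - \<alpha>) * P / 2))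
      = ennreal (C / 2 * P + K \<rho> + lam / 2 * ((\<beta> - \<alpha>) * P / 2))"
    using assms(1,2,3,13) P0 \<rho> unfolding C_def by (simp add: ennreal_plus)
  also have "C / 2 * P + K \<rho> + lam / 2 * ((\<beta> - \<alpha>) * P / 2) = K \<rho> + C\<^sub>M / 2 * P"
    unfolding C_def by (simp add: field_simps)
  also have "ennreal (K \<rho> + C\<^sub>M / 2 * P) + ennreal (lam / 2) * ?I v \<le> TV_Kg K lam g \<alpha> \<beta> v"
    unfolding TV_Kg_def by (intro add_right_mono TV_v)
  finally have "ennreal (C / 2 * Q) + TV_Kg K lam g \<alpha> \<beta> U\<^sub>0 \<le> TV_Kg K lam g \<alpha> \<beta> v" .
  then show ?thesis
    using v.countable_jump_set r_pos r_sum r2_sum Q(1,3)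
    unfolding Let_def C_def \<rho>_def J_def r_def Q_def by blast
qed

end
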